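(* Consider the Dirichlet problem $\partial u/\partial t=D(t)\Delta u+A(x,t)u+B(u,x,t)$ in $\Omega$, $u|_{\partial\Omega}=0$, $u(x,0)=u_0(x)$, with the assumptions and notation given in the context and with exponent $p=2$ (so $q=5/4$), and let $u$ be its solution. Suppose that $\sigma(t)=d(t)c(\Omega)+\gamma(t)$ satisfies $\sigma(t)\ge\sigma_0>0$ for all $t\ge 0$, where $\sigma_0$ is a constant. Choose $\mu(t)=\mu_0 e^{\nu t}$ with $\mu_0=g(0)^{-1}$ and $\nu=0.5\,\sigma_0$. If $$c_0(t)\,C(t)\le 0.5\, g(0)^{-1/4}\,e^{\frac18\sigma_0 t}\,\sigma_0\qquad\text{for all } t\ge 0,\qquad C(t):=c\,\|u(\cdot,t)\|_{H^2(\Omega)}^{3/4},$$ then $$\|u(\cdot,t)\|\le g(0)\,e^{-0.5\,\sigma_0 t}\qquad\text{for all } t\ge 0 .$$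
   Context: $\Omega\subset\mathbb R^{\mathcal M}$, $\mathcal M\le 3$, is a bounded domain with sufficiently smooth boundary; $u=(u_1,\dots,u_n)$ is $\mathbb R^n$-valued; $D(t)$ is a diagonal matrix with positive diagonal elements $d_i(t)$, and $d_i(t)\ge d(t)$ for $i=1,\dots,n$, $t\ge0$, where $d(t)$ is a positive function. The nonlinearity $F(u,x,t)=A(x,t)u+B(u,x,t)$, with $A(x,t)$ an $n\times n$ matrix, satisfies: $F(0,x,t)=0$ for $x\in\Omega$, $t\ge0$; $\sup_{u\in\mathbb R^n,\,x\in\mathbb R^{\mathcal M},\,t\ge0}|F(u,x,t)|\le M_1$ for a constant $M_1$; $|F(v,x,t)-F(w,x,s)|\le c_F(|t-s|+|v-w|)$ with a constant $c_F>0$ independent of $v,w,x,t,s$; $F$ is continuous in $x$. Moreover $\mathrm{Re}\,(A(x,t)u,u)\le-\gamma(t)|u|^2$ and $|B(u,x,t)|\le c_0(t)|u|^p$ with $p>1$, for all $u$, $x\in\Omega$, $t\ge0$, where $(\cdot,\cdot)$ is the inner product in $\mathbb R^n$, $|u|^2=\sum_{j=1}^n|u_j|^2$, and $\gamma$ is a real-valued function (not necessarily of constant sign). The initial function satisfies the compatibility condition $u_0=0$ on $\partial\Omega$. By the solution $u$ we mean the classical solution on $\Omega\times[0,\infty)$, with $u(\cdot,t)\in H^2(\Omega)$ for $t\ge0$. $\|\cdot\|$ is the $L^2(\Omega)$ norm and $g(t)=\|u(\cdot,t)\|$; it is assumed that $g(0)\ne0$. $c(\Omega)>0$ is a constant in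 the Poincaré inequality $c(\Omega)\int_\Omega|u|^2dx\le\int_\Omega|\nabla u|^2dx$ for functions vanishing on $\partial\Omega$. $c>0$ is a constant, independent of $u$, such that $\|u\|_{L^\infty(\Omega)}\le c\,\|u\|_{L^2(\Omega)}^{1/4}\|u\|_{H^2(\Omega)}^{3/4}$ for all $u\in H^2(\Omega)$. Set $\sigma(t)=d(t)c(\Omega)+\gamma(t)$, $\alpha(t)=c_0(t)c^{p-1}\|u(\cdot,t)\|_{H^2(\Omega)}^{3(p-1)/4}$, $q=(p+3)/4$. The functions $\sigma(t)$ and $\alpha(t)\ge0$ are assumed continuous on $[0,\infty)$. *)

theory Defs
  imports "HOL-Analysis.Analysis" "HOL-Probability.Essential_Supremum"
begin

section \<open>Classical derivatives\<close>

text \<open>An index list \<open>[i\<^sub>1, \<dots>, i\<^sub>k]\<close> plays the role of a multi-index of order \<open>k\<close>: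
  it denotes the iterated partial derivative in the coordinate directions listed.\<close>

fun partial_derivs ::
  "'m::finite list \<Rightarrow> (real^'m \<Rightarrow> 'b::real_normed_vector) \<Rightarrow> real^'m \<Rightarrow> 'b" where
  "partial_derivs [] f x = f x"
| "partial_derivs (i # is) f x = frechet_derivative (partial_derivs is f) (at x) (axis i 1)"

text \<open>Meant for open \<open>S\<close>.\<close>

definition C_k_on ::
  "nat \<Rightarrow> (real^'m::finite) set \<Rightarrow> (real^'m \<Rightarrow> 'b::real_normed_vector) \<Rightarrow> bool" where
  "C_k_on k S f \<longleftrightarrow>
     (\<forall>is. length is < k \<longrightarrow> (\<forall>x\<in>S. partial_derivs is f differentiable (at x))) \<and>
     (\<forall>is. length is \<le> k \<longrightarrow> continuous_on S (partial_derivs is f))"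

definition laplacian :: "(real^'m::finite \<Rightarrow> 'b::real_normed_vector) \<Rightarrow> real^'m \<Rightarrow> 'b" where
  "laplacian f x = (\<Sum>i\<in>UNIV. partial_derivs [i, i] f x)"

text \<open>Local defining functions with non-vanishing gradient; \<open>\<rho> = 0\<close> on the part of the
  boundary inside \<open>U\<close> follows when \<open>\<Omega>\<close> is open.\<close>

definition C_k_boundary :: "nat \<Rightarrow> (real^'m::finite) set \<Rightarrow> bool" where
  "C_k_boundary k \<Omega> \<longleftrightarrow>
     (\<forall>x\<in>frontier \<Omega>. \<exists>U (\<rho> :: real^'m \<Rightarrow> real).
        open U \<and> x \<in> U \<and> C_k_on k U \<rho> \<and>
        (\<forall>y\<in>U. \<exists>i. partial_derivs [i] \<rho> y \<noteq> 0) \<and>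
        \<Omega> \<inter> U = {y\<in>U. \<rho> y < 0})"


section \<open>Lebesgue and Sobolev spaces\<close>

definition L2_on :: "(real^'m::finite) set \<Rightarrow> (real^'m \<Rightarrow> 'b::euclidean_space) \<Rightarrow> bool" where
  "L2_on \<Omega> f \<longleftrightarrow>
     f \<in> borel_measurable (lebesgue_on \<Omega>) \<and> integrable (lebesgue_on \<Omega>) (\<lambda>x. (norm (f x))\<^sup>2)"

definition L2_norm_on :: "(real^'m::finite) set \<Rightarrow> (real^'m \<Rightarrow> 'b::euclidean_space) \<Rightarrow> real" where
  "L2_norm_on \<Omega> f = sqrt (LINT x|lebesgue_on \<Omega>. (norm (f x))\<^sup>2)"

definition test_function :: "(real^'m::finite) set \<Rightarrow> (real^'m \<Rightarrow> real) \<Rightarrow> bool" where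
  "test_function \<Omega> \<phi> \<longleftrightarrow>
     (\<forall>k. C_k_on k UNIV \<phi>) \<and>
     compact (closure {x. \<phi> x \<noteq> 0}) \<and> closure {x. \<phi> x \<noteq> 0} \<subseteq> \<Omega>"

text \<open>\<open>g\<close> is a weak derivative \<open>D\<^sup>i\<^sup>s f\<close>; only used for \<open>f\<close> and \<open>g\<close> in \<open>L\<^sup>2(\<Omega>)\<close>, so that the
  integrals exist.\<close>

definition has_weak_deriv ::
  "(real^'m::finite) set \<Rightarrow> 'm list \<Rightarrow>
   (real^'m \<Rightarrow> 'b::euclidean_space) \<Rightarrow> (real^'m \<Rightarrow> 'b) \<Rightarrow> bool" where
  "has_weak_deriv \<Omega> is f g \<longleftrightarrow>
     (\<forall>\<phi>. test_function \<Omega> \<phi> \<longrightarrow>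
        (LINT x|lebesgue_on \<Omega>. partial_derivs is \<phi> x *\<^sub>R f x) =
        (-1) ^ length is *\<^sub>R (LINT x|lebesgue_on \<Omega>. \<phi> x *\<^sub>R g x))"

definition sobolev_H ::
  "nat \<Rightarrow> (real^'m::finite) set \<Rightarrow> (real^'m \<Rightarrow> 'b::euclidean_space) \<Rightarrow> bool" where
  "sobolev_H k \<Omega> f \<longleftrightarrow>
     L2_on \<Omega> f \<and> (\<forall>is. length is \<le> k \<longrightarrow> (\<exists>g. L2_on \<Omega> g \<and> has_weak_deriv \<Omega> is f g))"

text \<open>Weak derivatives are unique almost everywhere in an open set, so the choice does not affect
  the norm below. That norm uses the full derivative tensors: the Hessian contributes the integral of
  \<open>\<Sum>\<^sub>i\<^sub>j |\<partial>\<^sub>i\<partial>\<^sub>j f|\<^sup>2\<close>.\<close>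

definition weak_deriv ::
  "(real^'m::finite) set \<Rightarrow> 'm list \<Rightarrow> (real^'m \<Rightarrow> 'b::euclidean_space) \<Rightarrow> real^'m \<Rightarrow> 'b" where
  "weak_deriv \<Omega> is f = (SOME g. L2_on \<Omega> g \<and> has_weak_deriv \<Omega> is f g)"

definition sobolev_norm ::
  "nat \<Rightarrow> (real^'m::finite) set \<Rightarrow> (real^'m \<Rightarrow> 'b::euclidean_space) \<Rightarrow> real" where
  "sobolev_norm k \<Omega> f = sqrt (\<Sum>is\<in>{is. length is \<le> k}. (L2_norm_on \<Omega> (weak_deriv \<Omega> is f))\<^sup>2)"

text \<open>The Poincare inequality for the \<open>H\<^sup>1\<close> functions that are continuous up to the
  boundary and vanish there; these are dense in \<open>H\<^sup>1\<^sub>0(\<Omega>)\<close>, so the admissible constants are those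
  for \<open>H\<^sup>1\<^sub>0(\<Omega>)\<close>. Vector-valued functions are covered by summing over the components.\<close>

definition poincare_constant :: "(real^'m::finite) set \<Rightarrow> real \<Rightarrow> bool" where
  "poincare_constant \<Omega> \<kappa> \<longleftrightarrow>
     \<kappa> > 0 \<and>
     (\<forall>(v :: real^'m \<Rightarrow> real) (w :: 'm \<Rightarrow> real^'m \<Rightarrow> real).
        L2_on \<Omega> v \<and> (\<forall>i. L2_on \<Omega> (w i) \<and> has_weak_deriv \<Omega> [i] v (w i)) \<and>
        continuous_on (closure \<Omega>) v \<and> (\<forall>x\<in>frontier \<Omega>. v x = 0) \<longrightarrow>
        \<kappa> * (LINT x|lebesgue_on \<Omega>. (v x)\<^sup>2) \<le>
        (LINT x|lebesgue_on \<Omega>. (\<Sum>i\<in>UNIV. (w i x)\<^sup>2)))"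


section \<open>The Dirichlet problem\<close>

text \<open>The unknown is \<open>u x t\<close> and the nonlinearity is \<open>F v x t\<close>. The derivatives and
  the equation are required for \<open>t > 0\<close> only, \<open>u\<close> itself is continuous up to the boundary
  and up to the initial time.\<close>

definition classical_solution ::
  "(real^'m::finite) set \<Rightarrow> (real \<Rightarrow> real^'n^'n) \<Rightarrow> (real^'n \<Rightarrow> real^'m \<Rightarrow> real \<Rightarrow> real^'n) \<Rightarrow>
   (real^'m \<Rightarrow> real^'n) \<Rightarrow> (real^'m \<Rightarrow> real \<Rightarrow> real^'n::finite) \<Rightarrow> bool" where
  "classical_solution \<Omega> D F u0 u \<longleftrightarrow>
     continuous_on (closure \<Omega> \<times> {0..}) (\<lambda>(x, t). u x t) \<and>
     (\<forall>x\<in>\<Omega>. \<forall>t>0. u x differentiable (at t)) \<and>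
     continuous_on (\<Omega> \<times> {0<..}) (\<lambda>(x, t). vector_derivative (u x) (at t)) \<and>
     (\<forall>t>0. C_k_on 2 \<Omega> (\<lambda>x. u x t)) \<and>
     (\<forall>is. length is \<le> 2 \<longrightarrow>
        continuous_on (\<Omega> \<times> {0<..}) (\<lambda>(x, t). partial_derivs is (\<lambda>y. u y t) x)) \<and>
     (\<forall>x\<in>\<Omega>. \<forall>t>0.
        vector_derivative (u x) (at t) = D t *v laplacian (\<lambda>y. u y t) x + F (u x t) x t) \<and>
     (\<forall>x\<in>frontier \<Omega>. \<forall>t\<ge>0. u x t = 0) \<and>
     (\<forall>x\<in>\<Omega>. u x 0 = u0 x)"

end

theory Submission
  imports Defs
begin

text \<open>The energy \<open>y(t) = \<parallel>u(\<cdot>,t)\<parallel>\<^sup>2\<close> satisfies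
  \<open>y' \<le> - 2 \<sigma> y + 2 c\<^sub>0 C y\<^bsup>9/8\<^esup>\<close>, and under the smallness hypothesis
  \<open>y(0) exp (- \<sigma>\<^sub>0 t)\<close> is a supersolution. A classical solution need not have derivatives that are
  integrable up to the boundary locally uniformly in time, so the energy identity is derived for
  \<open>\<Sum>\<^sub>i \<integral> 2 G(u\<^sub>i)\<close>, where \<open>2 G(s)\<close> approximates \<open>s\<^sup>2\<close> up to \<open>O(\<epsilon>)\<close> and vanishes for
  \<open>|s| \<le> \<epsilon>\<close>. As \<open>u\<close> is continuous and vanishes on the boundary, all integrands are then compactly
  supported in \<open>\<Omega>\<close>; the errors are \<open>O(\<epsilon>)\<close> uniformly on bounded time intervals.\<close>

section \<open>Truncation\<close>

text \<open>The barrier leaves no slack. Write g = sqrt y. The hypothesis bounds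
  \<open>c0 t * C t\<close> by \<open>\<sigma>0 / 2\<close> times g(0)^(-1/4)
  e^(\<open>\<sigma>0\<close> t / 8), and the exponent \<open>\<sigma>0 / 8\<close> is a quarter of
  the claimed decay rate \<open>\<sigma>0 / 2\<close> of g. Hence on the barrier g = g(0)
  e^(-\<open>\<sigma>0\<close> t / 2) the growth rate \<open>c0 t * C t * g t powr (1/4)\<close> is
  at most \<open>\<sigma>0 / 2\<close>. It uses up half of the damping -2 \<open>\<sigma>0\<close>
  y, and the remaining -\<open>\<sigma>0\<close> y is exactly the slope of the barrier.\<close>

lemma real_antiderivative:
  fixes f :: "real \<Rightarrow> real"
  assumes "continuous_on UNIV f"
  obtains F where "\<And>s. (F has_real_derivative f s) (at s)" "F 0 = 0"
proof -
  have "\<exists>F. \<forall>x::real. -\<infinity> < ereal x \<longrightarrow> ereal x < \<infinity> \<longrightarrow> (F has_vector_derivative f x) (at x)"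
    by (rule einterval_antiderivative)
       (use assms in \<open>auto simp: continuous_on_eq_continuous_at\<close>)
  then obtain F where F: "\<And>x. (F has_vector_derivative f x) (at x)"
    by auto
  show thesis
  proof
    show "((\<lambda>s. F s - F 0) has_real_derivative f s) (at s)" for s
      using F[of s] by (auto intro!: derivative_eq_intros simp: has_real_derivative_iff_has_vector_derivative)
  qed auto
qed

lemma real_deriv_bound:
  fixes f f' :: "real \<Rightarrow> real"
  assumes "\<And>s. (f has_real_derivative f' s) (at s)"
    and "\<And>s. s \<in> closed_segment a b \<Longrightarrow> \<bar>f' s\<bar> \<le> K"
  shows "\<bar>f b - f a\<bar> \<le> K * \<bar>b - a\<bar>"
proof -
  have "norm (f b - f a) \<le> K * norm (b - a)"
    by (rule field_differentiable_bound[where S = "closed_segment a b" and f' = f'])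
       (use assms in \<open>auto intro: has_field_derivative_at_within\<close>)
  then show ?thesis by simp
qed

text \<open>\<open>h\<close> is a \<open>C\<^sup>1\<close> approximation of the identity that vanishes near \<open>0\<close>. Because
  \<open>G'' = k\<close> dominates \<open>k\<^sup>2\<close>, the dissipation of the energy density \<open>G\<close> controls the gradient of
  \<open>h \<circ> v\<close>.\<close>

definition truncation :: "real \<Rightarrow> (real \<Rightarrow> real) \<Rightarrow> (real \<Rightarrow> real) \<Rightarrow> (real \<Rightarrow> real) \<Rightarrow> bool" where
  "truncation \<epsilon> k h G \<longleftrightarrow>
     \<epsilon> > 0 \<and> continuous_on UNIV k \<and>
     (\<forall>s. (h has_real_derivative k s) (at s)) \<and> (\<forall>s. (G has_real_derivative h s) (at s)) \<and>
     (\<forall>s. 0 \<le> k s \<and> k s \<le> 1) \<and>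
     (\<forall>s. \<bar>s\<bar> \<le> \<epsilon> \<longrightarrow> k s = 0 \<and> h s = 0 \<and> G s = 0) \<and>
     (\<forall>s. \<bar>h s - s\<bar> \<le> 2 * \<epsilon>) \<and> (\<forall>s. \<bar>2 * G s - s\<^sup>2\<bar> \<le> 4 * \<epsilon> * \<bar>s\<bar>)"

text \<open>The ramp \<open>k\<close> rises linearly from 0 at |s| = \<epsilon> to 1 at |s| =
  2\<epsilon>, and \<open>h\<close>, \<open>G\<close> are its successive antiderivatives normalised
  at 0. The slope of h(s) - s is at most 1 in modulus up to |s| = 2\<epsilon>, and zero beyond, so
  the error 2\<epsilon> is frozen there at its value at \<open>r\<close>. Since 2 G(s) - s^2 has
  derivative 2 (h(s) - s), one more integration gives 4\<epsilon>|s|.\<close>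

lemma truncation_exists:
  assumes "\<epsilon> > 0"
  obtains k h G where "truncation \<epsilon> k h G"
proof -
  define k where "k s = max 0 (min 1 (\<bar>s\<bar> / \<epsilon> - 1))" for s
  have ck: "continuous_on UNIV k"
    unfolding k_def using assms by (intro continuous_intros) auto
  have k01: "0 \<le> k s" "k s \<le> 1" for s
    by (auto simp: k_def)
  have k0: "k s = 0" if "\<bar>s\<bar> \<le> \<epsilon>" for s
    using that assms by (auto simp: k_def field_simps)
  have k1: "k s = 1" if "\<bar>s\<bar> \<ge> 2 * \<epsilon>" for s
    using that assms by (auto simp: k_def field_simps)
  obtain h where h: "\<And>s. (h has_real_derivative k s) (at s)" "h 0 = 0"
    using real_antiderivative[OF ck] by blast
  have "continuous_on UNIV h"
    using h(1) DERIV_isCont continuous_at_imp_continuous_on by blast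
  then obtain G where G: "\<And>s. (G has_real_derivative h s) (at s)" "G 0 = 0"
    using real_antiderivative by blast
  have seg: "\<bar>r\<bar> \<le> \<bar>s\<bar>" if "r \<in> closed_segment 0 s" for r s :: real
    using that by (auto simp: closed_segment_eq_real_ivl split: if_splits)
  have h0: "h s = 0" if "\<bar>s\<bar> \<le> \<epsilon>" for s
    using real_deriv_bound[OF h(1), of 0 s 0] seg[of _ s] that k0 h(2) by force
  have G0: "G s = 0" if "\<bar>s\<bar> \<le> \<epsilon>" for s
    using real_deriv_bound[OF G(1), of 0 s 0] seg[of _ s] that h0 G(2) by force
  have d: "((\<lambda>s. h s - s) has_real_derivative k s - 1) (at s)" for s
    using h(1) by (auto intro!: derivative_eq_intros)
  have hs: "\<bar>h s - s\<bar> \<le> 2 * \<epsilon>" for s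
  proof -
    have near: "\<bar>h s - s\<bar> \<le> 2 * \<epsilon>" if "\<bar>s\<bar> \<le> 2 * \<epsilon>" for s
      using real_deriv_bound[OF d, of 0 s 1] k01 h(2) that by (force simp: abs_le_iff)
    define r where "r = (if s \<ge> 0 then 2 * \<epsilon> else - (2 * \<epsilon>))"
    show ?thesis
    proof (cases "\<bar>s\<bar> \<le> 2 * \<epsilon>")
      case False
      have "k x = 1" if "x \<in> closed_segment r s" for x
        using that False assms
        by (intro k1) (auto simp: r_def closed_segment_eq_real_ivl split: if_splits)
      then have "\<bar>(h s - s) - (h r - r)\<bar> \<le> 0 * \<bar>s - r\<bar>"
        by (intro real_deriv_bound[OF d]) auto
      moreover have "\<bar>h r - r\<bar> \<le> 2 * \<epsilon>"
        using assms by (intro near) (auto simp: r_def)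
      ultimately show ?thesis by auto
    qed (rule near)
  qed
  have d2: "((\<lambda>s. 2 * G s - s\<^sup>2) has_real_derivative 2 * h s - 2 * s) (at s)" for s
    using G(1) by (auto intro!: derivative_eq_intros)
  have "\<bar>2 * h s - 2 * s\<bar> \<le> 4 * \<epsilon>" for s
    using hs[of s] by (auto simp: abs_le_iff)
  then have "\<bar>2 * G s - s\<^sup>2\<bar> \<le> 4 * \<epsilon> * \<bar>s\<bar>" for s
    using real_deriv_bound[OF d2, of 0 s "4 * \<epsilon>"] G(2) by simp
  then have "truncation \<epsilon> k h G"
    unfolding truncation_def using assms ck h(1) G(1) k01 k0 h0 G0 hs by blast
  then show thesis by (rule that)
qed

section \<open>A nonlinear Gronwall inequality\<close>

text \<open>The differential inequality is only required of approximations \<open>E\<close> of \<open>y\<close>, and only where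
  \<open>y\<close> lies above the claimed bound. After the last time at which \<open>y\<close> meets the bound, the
  excess satisfies a linear Gronwall inequality up to \<open>O(\<epsilon>)\<close>.\<close>

lemma nonlinear_decay:
  fixes y :: "real \<Rightarrow> real"
  assumes \<sigma>: "\<sigma> > 0" and y0: "y 0 > 0" and cont: "continuous_on {0..} y"
    and approx: "\<And>T. T > 0 \<Longrightarrow> \<exists>K\<ge>0. \<forall>\<epsilon>>0. \<exists>E E'. \<forall>t. 0 < t \<and> t \<le> T \<longrightarrow>
           \<bar>E t - y t\<bar> \<le> K * \<epsilon> \<and> (E has_real_derivative E' t) (at t) \<and>
           (y t \<ge> y 0 * exp (- \<sigma> * t) \<longrightarrow>
              E' t \<le> - 2 * \<sigma> * y t + \<sigma> * (y t * exp (\<sigma> * t) / y 0) * y t + K * \<epsilon>)"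
    and T: "T \<ge> 0"
  shows "y T \<le> y 0 * exp (- \<sigma> * T)"
proof (rule ccontr)
  assume "\<not> ?thesis"
  then have neg: "y T > y 0 * exp (- \<sigma> * T)" by simp
  \<comment> \<open>In this rescaling the claimed bound becomes \<open>z \<le> 0\<close>.\<close>
  define z where "z t = y t * exp (\<sigma> * t) - y 0" for t
  have pos_iff: "z t > 0 \<longleftrightarrow> y t > y 0 * exp (- \<sigma> * t)" for t
    by (simp add: z_def exp_minus field_simps)
  have z0: "z 0 = 0" by (simp add: z_def)
  have zT: "z T > 0" using neg pos_iff by simp
  have Tpos: "T > 0" using T zT z0 by (cases "T = 0") auto
  have cz: "continuous_on {0..T} z"
    unfolding z_def by (intro continuous_intros continuous_on_subset[OF cont]) auto
  define S where "S = {0..T} \<inter> z -` {..0}"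
  have "compact S"
    unfolding S_def compact_eq_bounded_closed
    by (auto intro!: continuous_closed_preimage[OF cz] bounded_subset[OF bounded_closed_interval])
  moreover have "0 \<in> S" using T z0 by (simp add: S_def)
  ultimately obtain s where s: "s \<in> S" "\<And>t. t \<in> S \<Longrightarrow> t \<le> s"
    using compact_attains_sup[of S] by blast
  have s0T: "0 \<le> s" "s < T" "z s \<le> 0"
    using s(1) zT by (auto simp: S_def less_le)
  have zpos: "z t > 0" if "s < t" "t \<le> T" for t
    using s(2)[of t] that s0T by (force simp: S_def)
  have "bounded (y ` {0..T})"
    by (intro compact_imp_bounded compact_continuous_image continuous_on_subset[OF cont]) auto
  then obtain Y where Y: "\<And>t. t \<in> {0..T} \<Longrightarrow> \<bar>y t\<bar> \<le> Y"
    unfolding bounded_iff by (metis imageI real_norm_def)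
  have Y0: "Y \<ge> 0" using Y[of 0] T by auto
  \<comment> \<open>\<open>\<sigma>\<close> times an upper bound on [0, T] for the ratio w = y(t)
    e^(\<open>\<sigma>\<close> t) / y(0) of \<open>y\<close> to the barrier. Formally z' \<le>
    \<open>\<sigma>\<close> w z, so \<open>L\<close> is the linear Gronwall constant as long as
    \<open>z\<close> is positive.\<close>
  define L where "L = \<sigma> * (Y * exp (\<sigma> * T) / y 0)"
  have L0: "L \<ge> 0" using \<sigma> y0 Y0 by (simp add: L_def)
  obtain K where K: "K \<ge> 0" and ap: "\<And>\<epsilon>. \<epsilon> > 0 \<Longrightarrow> \<exists>E E'. \<forall>t. 0 < t \<and> t \<le> T \<longrightarrow>
           \<bar>E t - y t\<bar> \<le> K * \<epsilon> \<and> (E has_real_derivative E' t) (at t) \<and>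
           (y t \<ge> y 0 * exp (- \<sigma> * t) \<longrightarrow>
              E' t \<le> - 2 * \<sigma> * y t + \<sigma> * (y t * exp (\<sigma> * t) / y 0) * y t + K * \<epsilon>)"
    using approx[OF Tpos] by blast
  define K3 where "K3 = (1 + \<sigma> + L) * K * exp (\<sigma> * T)"
  have K3: "K3 \<ge> 0" using \<sigma> L0 K by (simp add: K3_def)
  \<comment> \<open>\<open>K3 * T\<close> is the derivative error accumulated over [0, T]; the
    second summand pays for exchanging \<open>E\<close> and \<open>y\<close> at both ends of the
    interval.\<close>
  define K4 where "K4 = K3 * T + 2 * (K * exp (\<sigma> * T))"
  \<comment> \<open>\<open>y\<close> need not be differentiable, so the integrating factor is
    applied to \<open>E\<close>, and \<epsilon> is sent to 0 for fixed \<open>a\<close>. The start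
    \<open>a\<close> stays strictly beyond \<open>s\<close>, because \<open>s\<close> may be 0,
    where no derivative is available; a \<rightarrow> s is taken at the very end by continuity of
    \<open>z\<close>.\<close>
  have step: "z T * exp (- L * T) \<le> z a * exp (- L * a)" if a: "s < a" "a < T" for a
  proof (rule field_le_epsilon)
    fix e :: real assume e: "e > 0"
    define \<epsilon> where "\<epsilon> = e / (K4 + 1)"
    have K4: "K4 \<ge> 0" using K3 K T by (simp add: K4_def)
    have \<epsilon>: "\<epsilon> > 0" "K4 * \<epsilon> \<le> e" using e K4 by (auto simp: \<epsilon>_def field_simps)
    obtain E E' where E: "\<And>t. 0 < t \<Longrightarrow> t \<le> T \<Longrightarrow> \<bar>E t - y t\<bar> \<le> K * \<epsilon>"
      and dE: "\<And>t. 0 < t \<Longrightarrow> t \<le> T \<Longrightarrow> (E has_real_derivative E' t) (at t)"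
      and E'': "\<And>t. 0 < t \<Longrightarrow> t \<le> T \<Longrightarrow> y t \<ge> y 0 * exp (- \<sigma> * t) \<Longrightarrow>
              E' t \<le> - 2 * \<sigma> * y t + \<sigma> * (y t * exp (\<sigma> * t) / y 0) * y t + K * \<epsilon>"
      using ap[OF \<epsilon>(1)] by metis
    define P where "P t = (E t * exp (\<sigma> * t) - y 0) * exp (- L * t)" for t
    define P' where "P' t = ((E' t + \<sigma> * E t) * exp (\<sigma> * t) - L * (E t * exp (\<sigma> * t) - y 0)) * exp (- L * t)" for t
    have dP: "(P has_real_derivative P' t) (at t)" if "0 < t" "t \<le> T" for t
      unfolding P_def P'_def
      by (rule derivative_eq_intros dE that refl)+ (simp add: algebra_simps)
    have P'le: "P' t \<le> K3 * \<epsilon>" if t: "a \<le> t" "t \<le> T" for t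
    proof -
      have t0: "0 < t" "s < t" using t a s0T by auto
      have zt: "z t > 0" using zpos t0 t by simp
      have yt: "y t \<ge> y 0 * exp (- \<sigma> * t)" using pos_iff zt by (simp add: less_imp_le)
      define w where "w = y t * exp (\<sigma> * t) / y 0"
      have yw: "y t * exp (\<sigma> * t) = w * y 0" using y0 by (simp add: w_def)
      have zw: "z t = (w - 1) * y 0" using yw by (simp add: z_def algebra_simps)
      have et: "exp (\<sigma> * t) \<le> exp (\<sigma> * T)" using t \<sigma> by simp
      have "y t * exp (\<sigma> * t) \<le> Y * exp (\<sigma> * T)"
        using Y[of t] t t0 et Y0 by (intro mult_mono) auto
      then have "w \<le> Y * exp (\<sigma> * T) / y 0"
        using y0 unfolding w_def by (intro divide_right_mono) auto
      then have wL: "\<sigma> * w \<le> L" unfolding L_def using \<sigma> by (intro mult_left_mono) auto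
      have Et: "\<bar>E t - y t\<bar> \<le> K * \<epsilon>" using E t0 t by simp
      have b1: "E' t + \<sigma> * E t \<le> - \<sigma> * y t + \<sigma> * w * y t + (1 + \<sigma>) * (K * \<epsilon>)"
      proof -
        have "\<sigma> * E t \<le> \<sigma> * (y t + K * \<epsilon>)"
          using Et \<sigma> by (intro mult_left_mono) auto
        then show ?thesis using E''[OF t0(1) t(2) yt] by (simp add: w_def algebra_simps)
      qed
      have b2: "- (L * (E t * exp (\<sigma> * t) - y 0)) \<le> - L * z t + L * (K * \<epsilon>) * exp (\<sigma> * t)"
      proof -
        have "L * ((y t - E t) * exp (\<sigma> * t)) \<le> L * ((K * \<epsilon>) * exp (\<sigma> * t))"
          using Et L0 by (intro mult_left_mono mult_right_mono) auto
        then show ?thesis by (simp add: z_def algebra_simps)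
      qed
      have "(E' t + \<sigma> * E t) * exp (\<sigma> * t) \<le> (- \<sigma> * y t + \<sigma> * w * y t + (1 + \<sigma>) * (K * \<epsilon>)) * exp (\<sigma> * t)"
        using b1 by (intro mult_right_mono) auto
      \<comment> \<open>The barrier w = 1 solves the comparison equation exactly, so the excess
        equation has no source term: \<open>\<sigma> * (w - 1) * w * y 0\<close> is
        \<open>\<sigma> * w * z t\<close>, apart from the approximation error.\<close>
      also have "\<dots> = \<sigma> * (w - 1) * (y t * exp (\<sigma> * t)) + (1 + \<sigma>) * (K * \<epsilon>) * exp (\<sigma> * t)"
        by (simp add: algebra_simps)
      also have "\<sigma> * (w - 1) * (y t * exp (\<sigma> * t)) = \<sigma> * w * z t"
        unfolding yw zw by (simp add: algebra_simps)
      also have "\<sigma> * w * z t \<le> L * z t" using wL zt by (intro mult_right_mono) auto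
      finally have "(E' t + \<sigma> * E t) * exp (\<sigma> * t) - L * (E t * exp (\<sigma> * t) - y 0)
          \<le> (1 + \<sigma> + L) * (K * \<epsilon>) * exp (\<sigma> * t)"
        using b2 by (simp add: algebra_simps)
      also have "\<dots> \<le> (1 + \<sigma> + L) * (K * \<epsilon>) * exp (\<sigma> * T)"
        using et \<sigma> L0 K \<epsilon> by (intro mult_left_mono) auto
      also have "\<dots> = K3 * \<epsilon>" by (simp add: K3_def)
      finally have "P' t \<le> K3 * \<epsilon> * exp (- L * t)"
        unfolding P'_def by (intro mult_right_mono) auto
      also have "\<dots> \<le> K3 * \<epsilon> * 1"
        using K3 \<epsilon> L0 t0 by (intro mult_left_mono) auto
      finally show ?thesis by simp
    qed
    have "P T - K3 * \<epsilon> * T \<le> P a - K3 * \<epsilon> * a"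
    proof (rule DERIV_nonpos_imp_nonincreasing[of a T "\<lambda>t. P t - K3 * \<epsilon> * t"])
      fix t assume t: "a \<le> t" "t \<le> T"
      have "((\<lambda>t. P t - K3 * \<epsilon> * t) has_real_derivative P' t - K3 * \<epsilon>) (at t)"
        using t a s0T by (auto intro!: derivative_eq_intros dP)
      then show "\<exists>y. ((\<lambda>t. P t - K3 * \<epsilon> * t) has_real_derivative y) (at t) \<and> y \<le> 0"
        using P'le[OF t] by force
    qed (use a in auto)
    moreover have "0 \<le> K3 * \<epsilon> * a" using K3 \<epsilon> a s0T by simp
    ultimately have PT: "P T \<le> P a + K3 * T * \<epsilon>" by (simp add: algebra_simps)
    have close: "\<bar>P t - z t * exp (- L * t)\<bar> \<le> K * exp (\<sigma> * T) * \<epsilon>" if t: "0 < t" "t \<le> T" for t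
    proof -
      have "\<bar>P t - z t * exp (- L * t)\<bar> = \<bar>E t - y t\<bar> * exp (\<sigma> * t) * exp (- L * t)"
        by (simp add: P_def z_def abs_mult flip: left_diff_distrib)
      also have "\<dots> \<le> (K * \<epsilon>) * exp (\<sigma> * T) * 1"
        using E[OF t] t \<sigma> L0 K \<epsilon> by (intro mult_mono) auto
      finally show ?thesis by (simp add: mult_ac)
    qed
    have "z T * exp (- L * T) \<le> P T + K * exp (\<sigma> * T) * \<epsilon>"
      using close[of T] Tpos by (simp add: abs_le_iff)
    moreover have "P a \<le> z a * exp (- L * a) + K * exp (\<sigma> * T) * \<epsilon>"
      using close[of a] a s0T by (simp add: abs_le_iff)
    ultimately have "z T * exp (- L * T) \<le> z a * exp (- L * a) + K4 * \<epsilon>"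
      using PT by (simp add: K4_def algebra_simps)
    then show "z T * exp (- L * T) \<le> z a * exp (- L * a) + e"
      using \<epsilon>(2) by linarith
  qed
  have "continuous_on {s..T} (\<lambda>a. z a * exp (- L * a))"
    using s0T by (intro continuous_intros continuous_on_subset[OF cz]) auto
  then have "((\<lambda>a. z a * exp (- L * a)) \<longlongrightarrow> z s * exp (- L * s)) (at_right s)"
    using s0T(2) by (rule continuous_on_Icc_at_rightD)
  then have "z T * exp (- L * T) \<le> z s * exp (- L * s)"
    by (rule tendsto_lowerbound)
       (use step s0T in \<open>auto simp: eventually_at_right intro!: exI[of _ T]\<close>)
  moreover have "z s * exp (- L * s) \<le> 0" using s0T by (simp add: mult_nonpos_nonneg)
  moreover have "z T * exp (- L * T) > 0" using zT by simp
  ultimately show False by linarith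
qed

section \<open>Integrals of functions extended by zero\<close>

text \<open>Moves the Lebesgue integral over \<open>\<Omega>\<close> to a gauge integral over a box.
  There the Leibniz rule and continuity of parameter integrals only ask for joint continuity of the
  integrand.\<close>

lemma lebesgue_on_open_zero_ext:
  fixes f :: "'a::euclidean_space \<Rightarrow> real"
  assumes "open \<Omega>" and sub: "\<Omega> \<subseteq> cbox a b"
    and cont: "continuous_on UNIV f" and zero: "\<And>x. x \<notin> \<Omega> \<Longrightarrow> f x = 0"
  shows "integrable (lebesgue_on \<Omega>) f"
    and "integral\<^sup>L (lebesgue_on \<Omega>) f = integral (cbox a b) f"
proof -
  have meas: "\<Omega> \<in> sets lebesgue" "cbox a b \<in> sets lebesgue"
    using \<open>open \<Omega>\<close> by auto
  have f: "f = (\<lambda>x. if x \<in> \<Omega> then f x else 0)" "f = (\<lambda>x. if x \<in> cbox a b then f x else 0)"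
    using zero sub by (auto simp: fun_eq_iff)
  have int: "integrable (lebesgue_on (cbox a b)) f"
    by (intro continuous_imp_integrable continuous_on_subset[OF cont]) auto
  then have "integrable lebesgue f"
    using Lebesgue_Measure.integrable_restrict_UNIV[OF meas(2), of f] f(2) by simp
  then show "integrable (lebesgue_on \<Omega>) f"
    using Lebesgue_Measure.integrable_restrict_UNIV[OF meas(1), of f] f(1) by simp
  have "integral\<^sup>L (lebesgue_on \<Omega>) f = integral\<^sup>L (lebesgue_on (cbox a b)) f"
    using Lebesgue_Measure.integral_restrict[OF sub meas, of f] f(1) by simp
  also have "\<dots> = integral (cbox a b) f"
    using lebesgue_integral_eq_integral[OF int meas(2)] .
  finally show "integral\<^sup>L (lebesgue_on \<Omega>) f = integral (cbox a b) f" .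
qed

text \<open>The integrals of the translates of \<open>f\<close> are constant; differentiating under the integral
  gives the claim.\<close>

lemma integral_directional_derivative_eq_0:
  fixes f f' :: "'a::euclidean_space \<Rightarrow> real"
  assumes "open \<Omega>" "bounded \<Omega>"
    and cont: "continuous_on UNIV f" and zero: "\<And>x. x \<notin> \<Omega> \<Longrightarrow> f x = 0"
    and cont': "continuous_on UNIV f'" and zero': "\<And>x. x \<notin> \<Omega> \<Longrightarrow> f' x = 0"
    and deriv: "\<And>x. ((\<lambda>s. f (x + s *\<^sub>R e)) has_real_derivative f' x) (at 0)"
  shows "integral\<^sup>L (lebesgue_on \<Omega>) f' = 0"
proof -
  obtain R where R: "\<And>x. x \<in> \<Omega> \<Longrightarrow> norm x \<le> R"
    using \<open>bounded \<Omega>\<close> bounded_iff by blast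
  \<comment> \<open>The margin \<open>norm e\<close> lets the box contain the supports of all
    translates by \<open>s *\<^sub>R e\<close> with |s| < 1.\<close>
  have "bounded (cball (0::'a) (R + norm e))" by simp
  then obtain a where a: "cball (0::'a) (R + norm e) \<subseteq> cbox (-a) a"
    using bounded_subset_cbox_symmetric by blast
  define Q where "Q = cbox (-a) a"
  have \<Omega>Q: "\<Omega> \<subseteq> Q"
    using a R unfolding Q_def by (force intro: order_trans[OF R])
  \<comment> \<open>The hypothesis concerns s = 0 only, but holds at every base point; moving the
    base point along \<open>e\<close> gives the derivative at all \<open>s\<close>.\<close>
  have d: "((\<lambda>s. f (x + s *\<^sub>R e)) has_field_derivative f' (x + s *\<^sub>R e)) (at s within UNIV)" for x s
    using deriv[of "x + s *\<^sub>R e"] DERIV_shift[of "\<lambda>r. f (x + r *\<^sub>R e)" "f' (x + s *\<^sub>R e)" 0 s]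
    by (simp add: algebra_simps)
  have leib: "((\<lambda>s. integral Q (\<lambda>x. f (x + s *\<^sub>R e))) has_field_derivative
          integral Q (\<lambda>x. f' (x + 0 *\<^sub>R e))) (at 0 within UNIV)"
    unfolding Q_def
  proof (rule leibniz_rule_field_derivative[OF d])
    show "(\<lambda>x. f (x + s *\<^sub>R e)) integrable_on cbox (- a) a" for s
      by (intro integrable_continuous continuous_on_compose2[OF cont] continuous_intros) auto
    show "continuous_on (UNIV \<times> cbox (- a) a) (\<lambda>(s, x). f' (x + s *\<^sub>R e))"
      unfolding case_prod_unfold
      by (intro continuous_on_compose2[OF cont'] continuous_intros) auto
  qed auto
  have const: "integral Q (\<lambda>x. f (x + s *\<^sub>R e)) = integral Q f" if "\<bar>s\<bar> < 1" for s
  proof -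
    have out: "f (x + s *\<^sub>R e) = 0" if "x \<notin> Q" for x
    proof (rule zero)
      show "x + s *\<^sub>R e \<notin> \<Omega>"
      proof
        assume "x + s *\<^sub>R e \<in> \<Omega>"
        then have "norm (x + s *\<^sub>R e) \<le> R" using R by blast
        moreover have "norm (s *\<^sub>R e) \<le> norm e"
          using \<open>\<bar>s\<bar> < 1\<close> by (simp add: mult_left_le_one_le)
        moreover have "norm x \<le> norm (x + s *\<^sub>R e) + norm (s *\<^sub>R e)"
          using norm_triangle_ineq4[of "x + s *\<^sub>R e" "s *\<^sub>R e"] by simp
        ultimately have "norm x \<le> R + norm e" by linarith
        then show False using a that unfolding Q_def by auto
      qed
    qed
    have out0: "f x = 0" if "x \<notin> Q" for x
      using zero \<Omega>Q that by blast
    have "(f has_integral integral Q f) Q"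
      unfolding Q_def by (intro integrable_integral integrable_continuous continuous_on_subset[OF cont]) auto
    then have "((\<lambda>x. f (x + s *\<^sub>R e)) has_integral integral Q f) (cbox (- a - s *\<^sub>R e) (a - s *\<^sub>R e))"
      unfolding Q_def by (rule has_integral_shift_cbox)
    moreover have "f (x + s *\<^sub>R e) = 0" if "x \<notin> cbox (- a - s *\<^sub>R e) (a - s *\<^sub>R e)" for x
      using that by (intro out0) (auto simp: Q_def mem_box algebra_simps)
    ultimately have "((\<lambda>x. f (x + s *\<^sub>R e)) has_integral integral Q f) UNIV"
      using has_integral_on_superset[OF _ _ subset_UNIV] by blast
    then have "((\<lambda>x. if x \<in> Q then f (x + s *\<^sub>R e) else 0) has_integral integral Q f) UNIV"
      by (rule has_integral_eq[rotated]) (use out in auto)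
    then show ?thesis
      using has_integral_restrict_UNIV by blast
  qed
  have "((\<lambda>s. integral Q f) has_field_derivative integral Q f') (at 0)"
  proof (rule has_field_derivative_transform_within_open)
    show "((\<lambda>s. integral Q (\<lambda>x. f (x + s *\<^sub>R e))) has_field_derivative integral Q f') (at 0)"
      using leib by simp
    show "open {-1<..<1::real}" "0 \<in> {-1<..<1::real}" by auto
    show "integral Q (\<lambda>x. f (x + s *\<^sub>R e)) = integral Q f" if "s \<in> {-1<..<1}" for s
      using that by (intro const) auto
  qed
  then have "integral Q f' = 0"
    by (rule DERIV_unique[OF _ DERIV_const])
  then show ?thesis
    using lebesgue_on_open_zero_ext(2)[OF \<open>open \<Omega>\<close> _ cont' zero'] \<Omega>Q unfolding Q_def by simp
qed

lemma lebesgue_on_zero_ext: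
  fixes f :: "'a::euclidean_space \<Rightarrow> real"
  assumes "open \<Omega>" "bounded \<Omega>" and cont: "continuous_on UNIV (\<lambda>x. if x \<in> \<Omega> then f x else 0)"
  shows "integrable (lebesgue_on \<Omega>) f"
    and "\<Omega> \<subseteq> cbox a b \<Longrightarrow>
           integral\<^sup>L (lebesgue_on \<Omega>) f = integral (cbox a b) (\<lambda>x. if x \<in> \<Omega> then f x else 0)"
proof -
  let ?f = "\<lambda>x. if x \<in> \<Omega> then f x else 0"
  obtain c d where cd: "\<Omega> \<subseteq> cbox c d"
    using bounded_subset_cbox_symmetric[OF \<open>bounded \<Omega>\<close>] by blast
  have eq: "integrable (lebesgue_on \<Omega>) f \<longleftrightarrow> integrable (lebesgue_on \<Omega>) ?f"
    "integral\<^sup>L (lebesgue_on \<Omega>) f = integral\<^sup>L (lebesgue_on \<Omega>) ?f"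
    by (intro Bochner_Integration.integrable_cong Bochner_Integration.integral_cong; simp)+
  show "integrable (lebesgue_on \<Omega>) f"
    unfolding eq by (rule lebesgue_on_open_zero_ext(1)[OF \<open>open \<Omega>\<close> cd cont]) auto
  show "integral\<^sup>L (lebesgue_on \<Omega>) f = integral (cbox a b) ?f" if "\<Omega> \<subseteq> cbox a b"
    unfolding eq by (rule lebesgue_on_open_zero_ext(2)[OF \<open>open \<Omega>\<close> that cont]) auto
qed

section \<open>Truncated functions with zero boundary values\<close>

lemma partial_derivs_Nil [simp]: "partial_derivs [] f = f"
  by (rule ext) simp

lemma has_vector_derivative_partial_derivs:
  assumes "partial_derivs is f differentiable (at x)"
  shows "((\<lambda>s. partial_derivs is f (x + s *\<^sub>R axis j 1)) has_vector_derivative partial_derivs (j # is) f x) (at 0)"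
proof -
  let ?f = "partial_derivs is f"
  have "(?f has_derivative frechet_derivative ?f (at x)) (at (x + 0 *\<^sub>R axis j 1))"
    using assms by (simp add: frechet_derivative_works)
  then have "((\<lambda>s. ?f (x + s *\<^sub>R axis j 1)) has_derivative
      (\<lambda>s. frechet_derivative ?f (at x) (s *\<^sub>R axis j 1))) (at 0)"
    by (rule has_derivative_compose[rotated]) (auto intro!: derivative_eq_intros)
  then show ?thesis
    using linear_frechet_derivative[OF assms]
    by (simp add: has_vector_derivative_def linear_scale)
qed

text \<open>One scalar component of the solution, detached from the equation: \<open>v'\<close> is
  its time derivative, \<open>p j\<close> and \<open>q j\<close> its first and pure second
  derivatives along axis \<open>j\<close>. Only \<open>v\<close> is controlled up to the boundary
  and up to t = 0. The derivatives are merely continuous inside the open cylinder, so below they are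
  integrated only together with a factor that vanishes for |v| \<le> \<epsilon>.\<close>

locale dirichlet_function =
  fixes \<Omega> :: "(real^'m::finite) set"
    and v v' :: "real^'m \<Rightarrow> real \<Rightarrow> real"
    and p q :: "'m \<Rightarrow> real^'m \<Rightarrow> real \<Rightarrow> real"
  assumes open_\<Omega>: "open \<Omega>" and bounded_\<Omega>: "bounded \<Omega>"
    and cont_v: "continuous_on (closure \<Omega> \<times> {0..}) (\<lambda>(x, t). v x t)"
    and v_frontier: "\<And>x t. x \<in> frontier \<Omega> \<Longrightarrow> t \<ge> 0 \<Longrightarrow> v x t = 0"
    and v_time: "\<And>x t. x \<in> \<Omega> \<Longrightarrow> t > 0 \<Longrightarrow> (v x has_real_derivative v' x t) (at t)"
    and cont_v': "continuous_on (\<Omega> \<times> {0<..}) (\<lambda>(x, t). v' x t)"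
    and v_space: "\<And>x t j. x \<in> \<Omega> \<Longrightarrow> t > 0 \<Longrightarrow>
           ((\<lambda>s. v (x + s *\<^sub>R axis j 1) t) has_real_derivative p j x t) (at 0)"
    and cont_p: "\<And>j. continuous_on (\<Omega> \<times> {0<..}) (\<lambda>(x, t). p j x t)"
    and p_space: "\<And>x t j. x \<in> \<Omega> \<Longrightarrow> t > 0 \<Longrightarrow>
           ((\<lambda>s. p j (x + s *\<^sub>R axis j 1) t) has_real_derivative q j x t) (at 0)"
    and cont_q: "\<And>j. continuous_on (\<Omega> \<times> {0<..}) (\<lambda>(x, t). q j x t)"
begin

text \<open>Two closed pieces are glued, the closed cylinder and the complement of the open one.
  They overlap over the frontier, where \<open>v\<close> is 0 and \<open>\<Phi> 0 = 0\<close> makes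
  the two formulas agree.\<close>

lemma continuous_zero_ext:
  assumes "continuous_on UNIV \<Phi>" "\<Phi> 0 = 0"
  shows "continuous_on (UNIV \<times> {0..}) (\<lambda>(x, t). if x \<in> \<Omega> then \<Phi> (v x t) else (0::real))"
proof -
  have "continuous_on (closure \<Omega> \<times> {0..} \<union> (- \<Omega>) \<times> {0..})
          (\<lambda>z. if fst z \<in> \<Omega> then \<Phi> (case z of (x, t) \<Rightarrow> v x t) else 0)"
  proof (rule continuous_on_If)
    show "continuous_on (closure \<Omega> \<times> {0..}) (\<lambda>z. \<Phi> (case z of (x, t) \<Rightarrow> v x t))"
      by (rule continuous_on_compose2[OF assms(1) cont_v]) auto
    have "v x t = 0" if "x \<in> closure \<Omega>" "x \<notin> \<Omega>" "t \<ge> 0" for x t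
      using v_frontier[of x t] that open_\<Omega> by (simp add: frontier_def interior_open)
    then show "\<Phi> (case z of (x, t) \<Rightarrow> v x t) = 0"
      if "z \<in> closure \<Omega> \<times> {0..}" "fst z \<notin> \<Omega>" for z
      using that assms(2) by (auto simp: split: prod.splits)
  qed (use open_\<Omega> in \<open>auto intro!: closed_Times\<close>)
  moreover have "closure \<Omega> \<times> {0..} \<union> (- \<Omega>) \<times> {0..} = (UNIV :: (real^'m) set) \<times> {0::real..}"
    using closure_subset by auto
  ultimately have "continuous_on (UNIV \<times> {0..})
          (\<lambda>z. if fst z \<in> \<Omega> then \<Phi> (case z of (x, t) \<Rightarrow> v x t) else 0)"
    by simp
  then show ?thesis
    by (rule continuous_on_eq) auto
qed

text \<open>The open region in which every cut-off expression is identically zero. It is written as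
  a difference because {|v| \<ge> \<epsilon>} is closed in the closed cylinder, which yields
  openness. By the boundary condition it contains all points outside \<open>\<Omega>\<close> at
  positive times when \<epsilon> > 0, so together with the open cylinder it covers the upper half
  space.\<close>

definition away :: "real \<Rightarrow> ((real^'m) \<times> real) set" where
  "away \<epsilon> = UNIV \<times> {0<..} - {z \<in> closure \<Omega> \<times> {0..}. \<epsilon> \<le> \<bar>case z of (x, t) \<Rightarrow> v x t\<bar>}"

lemma open_away: "open (away \<epsilon>)"
proof -
  have "closed ((closure \<Omega> \<times> {0..}) \<inter> (\<lambda>z. \<bar>case z of (x, t) \<Rightarrow> v x t\<bar>) -` {\<epsilon>..})"
    by (intro continuous_closed_preimage closed_Times continuous_on_rabs cont_v) auto
  moreover have "(closure \<Omega> \<times> {0..}) \<inter> (\<lambda>z. \<bar>case z of (x, t) \<Rightarrow> v x t\<bar>) -` {\<epsilon>..}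
      = {z \<in> closure \<Omega> \<times> {0..}. \<epsilon> \<le> \<bar>case z of (x, t) \<Rightarrow> v x t\<bar>}"
    by auto
  ultimately show ?thesis
    unfolding away_def by (intro open_Diff open_Times) auto
qed

lemma away_iff: "(x, t) \<in> away \<epsilon> \<longleftrightarrow> t > 0 \<and> (x \<in> closure \<Omega> \<longrightarrow> \<bar>v x t\<bar> < \<epsilon>)"
  by (auto simp: away_def)

lemma outside_away: "x \<notin> \<Omega> \<Longrightarrow> t > 0 \<Longrightarrow> \<epsilon> > 0 \<Longrightarrow> (x, t) \<in> away \<epsilon>"
  using v_frontier[of x t] open_\<Omega> by (auto simp: away_iff frontier_def interior_open)

text \<open>\<open>r\<close> may blow up at the boundary, so gluing along closed sets fails. Instead
  two open sets are used: the open cylinder, where the product is continuous, and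
  \<open>away \<epsilon>\<close>, where it vanishes.\<close>

lemma continuous_cutoff_ext:
  assumes "\<epsilon> > 0" and \<Phi>: "continuous_on UNIV \<Phi>" "\<And>s. \<bar>s\<bar> \<le> \<epsilon> \<Longrightarrow> \<Phi> s = 0"
    and r: "continuous_on (\<Omega> \<times> {0<..}) (\<lambda>(x, t). r x t)"
  shows "continuous_on (UNIV \<times> {0<..}) (\<lambda>(x, t). if x \<in> \<Omega> then \<Phi> (v x t) * r x t else (0::real))"
    (is "continuous_on _ ?f")
proof -
  have "continuous_on (\<Omega> \<times> {0<..}) (\<lambda>z. \<Phi> (case z of (x, t) \<Rightarrow> v x t) * (case z of (x, t) \<Rightarrow> r x t))"
    by (intro continuous_intros r continuous_on_compose2[OF \<Phi>(1)] continuous_on_subset[OF cont_v])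
       (use closure_subset in force)+
  then have "continuous_on (\<Omega> \<times> {0<..}) ?f"
    by (rule continuous_on_eq) auto
  moreover have "continuous_on (away \<epsilon>) ?f"
    by (rule continuous_on_eq[OF continuous_on_const[of _ 0]])
       (use \<Phi>(2) closure_subset in \<open>force simp: away_iff\<close>)
  ultimately have "continuous_on (\<Omega> \<times> {0<..} \<union> away \<epsilon>) ?f"
    by (intro continuous_on_open_Un open_away open_Times open_\<Omega>) auto
  moreover have "\<Omega> \<times> {0<..} \<union> away \<epsilon> = UNIV \<times> {0<..}"
  proof (intro equalityI subsetI)
    fix z :: "(real^'m) \<times> real" assume "z \<in> UNIV \<times> {0<..}"
    then show "z \<in> \<Omega> \<times> {0<..} \<union> away \<epsilon>"
      using outside_away[of "fst z" "snd z"] \<open>\<epsilon> > 0\<close> by (cases z) auto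
  qed (auto simp: away_def)
  ultimately show ?thesis by simp
qed

lemma continuous_cutoff_ext_at:
  assumes "\<epsilon> > 0" "continuous_on UNIV \<Phi>" "\<And>s. \<bar>s\<bar> \<le> \<epsilon> \<Longrightarrow> \<Phi> s = 0"
    "continuous_on (\<Omega> \<times> {0<..}) (\<lambda>(x, t). r x t)" "t > 0"
  shows "continuous_on UNIV (\<lambda>x. if x \<in> \<Omega> then \<Phi> (v x t) * r x t else (0::real))"
proof -
  have "continuous_on UNIV (\<lambda>x. case (x, t) of (x, t) \<Rightarrow> if x \<in> \<Omega> then \<Phi> (v x t) * r x t else 0)"
    by (rule continuous_on_compose2[OF continuous_cutoff_ext[OF assms(1-4)]])
       (use assms(5) in \<open>auto intro!: continuous_intros\<close>)
  then show ?thesis by simp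
qed

text \<open>At a point outside \<open>\<Omega>\<close>, boundary points included, a whole segment of
  the line through it stays in the open set \<open>away \<epsilon>\<close>. The extended function is
  zero along that segment, hence so is its derivative.\<close>

lemma deriv_cutoff_ext:
  assumes "\<epsilon> > 0" and \<Phi>: "\<And>s. \<bar>s\<bar> \<le> \<epsilon> \<Longrightarrow> \<Phi> s = 0" and "t > 0"
    and inside: "\<And>x. x \<in> \<Omega> \<Longrightarrow> ((\<lambda>s. \<Phi> (v (x + s *\<^sub>R e) t) * r (x + s *\<^sub>R e)) has_real_derivative f' x) (at 0)"
  shows "((\<lambda>s. if x + s *\<^sub>R e \<in> \<Omega> then \<Phi> (v (x + s *\<^sub>R e) t) * r (x + s *\<^sub>R e) else 0)
           has_real_derivative (if x \<in> \<Omega> then f' x else 0)) (at 0)"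
proof (cases "x \<in> \<Omega>")
  case True
  have "open ((\<lambda>s::real. x + s *\<^sub>R e) -` \<Omega>)"
    using open_\<Omega> by (intro open_vimage continuous_intros)
  with inside[OF True] have "((\<lambda>s. if x + s *\<^sub>R e \<in> \<Omega> then \<Phi> (v (x + s *\<^sub>R e) t) * r (x + s *\<^sub>R e) else 0)
           has_real_derivative f' x) (at 0)"
    by (rule has_field_derivative_transform_within_open) (use True in auto)
  then show ?thesis using True by simp
next
  case False
  have "open ((\<lambda>s::real. (x + s *\<^sub>R e, t)) -` away \<epsilon>)"
    using open_away by (intro open_vimage continuous_intros)
  moreover have "0 \<in> (\<lambda>s::real. (x + s *\<^sub>R e, t)) -` away \<epsilon>"
    using outside_away[OF False] assms by simp
  moreover have "\<Phi> (v (x + s *\<^sub>R e) t) = 0"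
    if "s \<in> (\<lambda>s::real. (x + s *\<^sub>R e, t)) -` away \<epsilon>" "x + s *\<^sub>R e \<in> \<Omega>" for s
    using that \<Phi> closure_subset[of \<Omega>] by (force simp: away_iff)
  ultimately have "((\<lambda>s. if x + s *\<^sub>R e \<in> \<Omega> then \<Phi> (v (x + s *\<^sub>R e) t) * r (x + s *\<^sub>R e) else 0)
           has_real_derivative 0) (at 0)"
    by (intro has_field_derivative_transform_within_open[OF DERIV_const[of 0]]) auto
  then show ?thesis using False by simp
qed

lemma integrable_comp:
  fixes \<Phi> :: "real \<Rightarrow> real"
  assumes "continuous_on UNIV \<Phi>" "\<Phi> 0 = 0" "t \<ge> 0"
  shows "integrable (lebesgue_on \<Omega>) (\<lambda>x. \<Phi> (v x t))"
proof (rule lebesgue_on_zero_ext(1)[OF open_\<Omega> bounded_\<Omega>])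
  have "continuous_on UNIV (\<lambda>x. case (x, t) of (x, t) \<Rightarrow> if x \<in> \<Omega> then \<Phi> (v x t) else 0)"
    by (rule continuous_on_compose2[OF continuous_zero_ext[OF assms(1,2)]])
       (use assms(3) in \<open>auto intro!: continuous_intros\<close>)
  then show "continuous_on UNIV (\<lambda>x. if x \<in> \<Omega> then \<Phi> (v x t) else 0)" by simp
qed

lemma continuous_integral_comp:
  fixes \<Phi> :: "real \<Rightarrow> real"
  assumes "continuous_on UNIV \<Phi>" "\<Phi> 0 = 0"
  shows "continuous_on {0..} (\<lambda>t. integral\<^sup>L (lebesgue_on \<Omega>) (\<lambda>x. \<Phi> (v x t)))"
proof -
  obtain a b where ab: "\<Omega> \<subseteq> cbox a b"
    using bounded_subset_cbox_symmetric[OF bounded_\<Omega>] by blast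
  have c: "continuous_on ({0..} \<times> UNIV) (\<lambda>(t, x). if x \<in> \<Omega> then \<Phi> (v x t) else 0)"
  proof -
    have "continuous_on ({0..} \<times> UNIV) (\<lambda>z. case prod.swap z of (x, t) \<Rightarrow> if x \<in> \<Omega> then \<Phi> (v x t) else 0)"
      by (rule continuous_on_compose2[OF continuous_zero_ext[OF assms]])
         (auto intro!: continuous_intros)
    then show ?thesis by (rule continuous_on_eq) auto
  qed
  have "continuous_on {0..} (\<lambda>t. integral (cbox a b) (\<lambda>x. if x \<in> \<Omega> then \<Phi> (v x t) else 0))"
    by (intro integral_continuous_on_param continuous_on_subset[OF c]) auto
  moreover have "integral (cbox a b) (\<lambda>x. if x \<in> \<Omega> then \<Phi> (v x t) else 0)
      = integral\<^sup>L (lebesgue_on \<Omega>) (\<lambda>x. \<Phi> (v x t))" if "t \<ge> 0" for t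
  proof (rule lebesgue_on_zero_ext(2)[OF open_\<Omega> bounded_\<Omega> _ ab, symmetric])
    have "continuous_on UNIV (\<lambda>x. case (t, x) of (t, x) \<Rightarrow> if x \<in> \<Omega> then \<Phi> (v x t) else 0)"
      by (rule continuous_on_compose2[OF c]) (use that in \<open>auto intro!: continuous_intros\<close>)
    then show "continuous_on UNIV (\<lambda>x. if x \<in> \<Omega> then \<Phi> (v x t) else 0)" by simp
  qed
  ultimately show ?thesis
    by (rule continuous_on_eq) auto
qed

lemma integrable_cutoff:
  fixes \<Phi> :: "real \<Rightarrow> real"
  assumes "\<epsilon> > 0" "continuous_on UNIV \<Phi>" "\<And>s. \<bar>s\<bar> \<le> \<epsilon> \<Longrightarrow> \<Phi> s = 0"
    "continuous_on (\<Omega> \<times> {0<..}) (\<lambda>(x, t). r x t)" "t > 0"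
  shows "integrable (lebesgue_on \<Omega>) (\<lambda>x. \<Phi> (v x t) * r x t)"
  by (rule lebesgue_on_zero_ext(1)[OF open_\<Omega> bounded_\<Omega> continuous_cutoff_ext_at[OF assms]])

section \<open>Energy identity and dissipation for a fixed truncation\<close>

context
  fixes \<epsilon> :: real and k h G :: "real \<Rightarrow> real"
  assumes trunc: "truncation \<epsilon> k h G"
begin

lemma
  shows eps: "\<epsilon> > 0" and cont_k: "continuous_on UNIV k"
    and deriv_h: "\<And>s. (h has_real_derivative k s) (at s)"
    and deriv_G: "\<And>s. (G has_real_derivative h s) (at s)"
    and k01: "\<And>s. 0 \<le> k s" "\<And>s. k s \<le> 1"
    and vanish: "\<And>s. \<bar>s\<bar> \<le> \<epsilon> \<Longrightarrow> k s = 0" "\<And>s. \<bar>s\<bar> \<le> \<epsilon> \<Longrightarrow> h s = 0" "\<And>s. \<bar>s\<bar> \<le> \<epsilon> \<Longrightarrow> G s = 0"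
    and cont_h: "continuous_on UNIV h" and cont_G: "continuous_on UNIV G"
  using trunc unfolding truncation_def
  by (auto intro!: continuous_at_imp_continuous_on intro: DERIV_isCont)

text \<open>Differentiation under the integral needs a jointly continuous derivative on a full box.
  The zero extension of h(v) v' provides it, although \<open>v'\<close> alone may be unbounded near
  the boundary.\<close>

lemma deriv_energy:
  assumes "t > 0"
  shows "((\<lambda>t. integral\<^sup>L (lebesgue_on \<Omega>) (\<lambda>x. G (v x t))) has_real_derivative
           integral\<^sup>L (lebesgue_on \<Omega>) (\<lambda>x. h (v x t) * v' x t)) (at t)"
proof -
  obtain a b where ab: "\<Omega> \<subseteq> cbox a b"
    using bounded_subset_cbox_symmetric[OF bounded_\<Omega>] by blast
  let ?f = "\<lambda>t x. if x \<in> \<Omega> then G (v x t) else 0"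
  let ?f' = "\<lambda>t x. if x \<in> \<Omega> then h (v x t) * v' x t else 0"
  have cont: "continuous_on UNIV (?f s)" if "s > 0" for s
    using continuous_cutoff_ext_at[OF eps cont_G vanish(3), of "\<lambda>_ _. 1" s] that
    by (simp add: case_prod_unfold cong: if_cong)
  have int: "integral\<^sup>L (lebesgue_on \<Omega>) (\<lambda>x. G (v x s)) = integral (cbox a b) (?f s)" if "s > 0" for s
    by (rule lebesgue_on_zero_ext(2)[OF open_\<Omega> bounded_\<Omega> cont[OF that] ab])
  have "((\<lambda>s. integral (cbox a b) (?f s)) has_real_derivative integral (cbox a b) (?f' t)) (at t within {0<..})"
  proof (rule leibniz_rule_field_derivative)
    show "((\<lambda>s. ?f s x) has_real_derivative ?f' s x) (at s within {0<..})" if "s \<in> {0<..}" for s x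
      using that DERIV_chain2[OF deriv_G v_time[of x s]]
      by (auto intro: has_field_derivative_at_within)
    show "?f s integrable_on cbox a b" if "s \<in> {0<..}" for s
      using that by (intro integrable_continuous continuous_on_subset[OF cont]) auto
    have "continuous_on ({0<..} \<times> cbox a b)
            (\<lambda>z. case prod.swap z of (x, t) \<Rightarrow> if x \<in> \<Omega> then h (v x t) * v' x t else 0)"
      by (rule continuous_on_compose2[OF continuous_cutoff_ext[OF eps cont_h vanish(2) cont_v']])
         (auto intro!: continuous_intros)
    then show "continuous_on ({0<..} \<times> cbox a b) (\<lambda>(s, x). ?f' s x)"
      by (rule continuous_on_eq) auto
  qed (use assms in auto)
  then have "((\<lambda>s. integral (cbox a b) (?f s)) has_real_derivative integral (cbox a b) (?f' t)) (at t)"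
    using assms at_within_open[of t "{0<..}"] by simp
  moreover have "integral\<^sup>L (lebesgue_on \<Omega>) (\<lambda>x. h (v x t) * v' x t) = integral (cbox a b) (?f' t)"
    by (rule lebesgue_on_zero_ext(2)[OF open_\<Omega> bounded_\<Omega>
          continuous_cutoff_ext_at[OF eps cont_h vanish(2) cont_v' assms] ab])
  ultimately have "((\<lambda>s. integral (cbox a b) (?f s)) has_real_derivative
      integral\<^sup>L (lebesgue_on \<Omega>) (\<lambda>x. h (v x t) * v' x t)) (at t)"
    by simp
  then show ?thesis
    by (rule has_field_derivative_transform_within_open[where S = "{0<..}"])
       (use assms int in auto)
qed

lemma integrable_gradient_terms:
  assumes "t > 0"
  shows "integrable (lebesgue_on \<Omega>) (\<lambda>x. k (v x t) * (p j x t)\<^sup>2)"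
    and "integrable (lebesgue_on \<Omega>) (\<lambda>x. (k (v x t) * p j x t)\<^sup>2)"
    and "integrable (lebesgue_on \<Omega>) (\<lambda>x. h (v x t) * q j x t)"
proof -
  have p2: "continuous_on (\<Omega> \<times> {0<..}) (\<lambda>(x, t). (p j x t)\<^sup>2)"
    using continuous_on_power[OF cont_p[of j], of 2] by (simp add: case_prod_unfold)
  show "integrable (lebesgue_on \<Omega>) (\<lambda>x. k (v x t) * (p j x t)\<^sup>2)"
    by (rule integrable_cutoff[OF eps cont_k vanish(1) p2 assms])
  show "integrable (lebesgue_on \<Omega>) (\<lambda>x. (k (v x t) * p j x t)\<^sup>2)"
    using integrable_cutoff[OF eps _ _ p2 assms, of "\<lambda>s. (k s)\<^sup>2"] vanish(1) cont_k
    by (simp add: power_mult_distrib continuous_on_power)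
  show "integrable (lebesgue_on \<Omega>) (\<lambda>x. h (v x t) * q j x t)"
    by (rule integrable_cutoff[OF eps cont_h vanish(2) cont_q assms])
qed

lemma deriv_truncated:
  assumes "x \<in> \<Omega>" "t > 0"
  shows "((\<lambda>s. h (v (x + s *\<^sub>R axis j 1) t)) has_real_derivative k (v x t) * p j x t) (at 0)"
  using DERIV_chain2[OF deriv_h v_space[OF assms, of j]] by simp

text \<open>The flux h(v) times \<open>p j\<close> vanishes near the boundary, so its zero extension
  is differentiable along axis \<open>j\<close> everywhere and the derivative integrates to 0. The
  product rule splits that derivative into the two integrands.\<close>

lemma integration_by_parts:
  assumes t: "t > 0"
  shows "integral\<^sup>L (lebesgue_on \<Omega>) (\<lambda>x. h (v x t) * q j x t) =
         - integral\<^sup>L (lebesgue_on \<Omega>) (\<lambda>x. k (v x t) * (p j x t)\<^sup>2)"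
proof -
  let ?f = "\<lambda>x. if x \<in> \<Omega> then h (v x t) * p j x t else 0"
  let ?f' = "\<lambda>x. if x \<in> \<Omega> then k (v x t) * (p j x t)\<^sup>2 + h (v x t) * q j x t else 0"
  have p2: "continuous_on (\<Omega> \<times> {0<..}) (\<lambda>(x, t). (p j x t)\<^sup>2)"
    using continuous_on_power[OF cont_p[of j], of 2] by (simp add: case_prod_unfold)
  have "integral\<^sup>L (lebesgue_on \<Omega>) ?f' = 0"
  proof (rule integral_directional_derivative_eq_0[OF open_\<Omega> bounded_\<Omega>])
    show "continuous_on UNIV ?f"
      by (rule continuous_cutoff_ext_at[OF eps cont_h vanish(2) cont_p t])
    have "continuous_on UNIV (\<lambda>x. (if x \<in> \<Omega> then k (v x t) * (p j x t)\<^sup>2 else 0)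
            + (if x \<in> \<Omega> then h (v x t) * q j x t else 0))"
      by (intro continuous_on_add continuous_cutoff_ext_at[OF eps cont_k vanish(1) p2 t]
          continuous_cutoff_ext_at[OF eps cont_h vanish(2) cont_q t])
    then show "continuous_on UNIV ?f'"
      by (rule continuous_on_eq) auto
    show "((\<lambda>s. ?f (x + s *\<^sub>R axis j 1)) has_real_derivative ?f' x) (at 0)" for x
    proof (rule deriv_cutoff_ext[OF eps vanish(2) t])
      fix x assume x: "x \<in> \<Omega>"
      show "((\<lambda>s. h (v (x + s *\<^sub>R axis j 1) t) * p j (x + s *\<^sub>R axis j 1) t) has_real_derivative
           k (v x t) * (p j x t)\<^sup>2 + h (v x t) * q j x t) (at 0)"
        using DERIV_mult[OF deriv_truncated[OF x t, of j] p_space[OF x t, of j]]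
        by (simp add: power2_eq_square algebra_simps)
    qed
  qed auto
  moreover have "integral\<^sup>L (lebesgue_on \<Omega>) ?f' =
      integral\<^sup>L (lebesgue_on \<Omega>) (\<lambda>x. k (v x t) * (p j x t)\<^sup>2 + h (v x t) * q j x t)"
    by (rule Bochner_Integration.integral_cong) auto
  ultimately show ?thesis
    using integrable_gradient_terms[OF t, of j] by simp
qed

text \<open>The Poincare constant is defined through weak derivatives, so the classical gradient of
  h(v) has to be recognised as a weak one. The product of \<phi> with the extended h(v) vanishes
  outside \<open>\<Omega>\<close>, and the integral of its directional derivative is 0.\<close>

lemma weak_deriv_truncated:
  assumes t: "t > 0"
  shows "has_weak_deriv \<Omega> [j] (\<lambda>x. if x \<in> \<Omega> then h (v x t) else 0)
           (\<lambda>x. if x \<in> \<Omega> then k (v x t) * p j x t else 0)"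
  unfolding has_weak_deriv_def
proof (intro allI impI)
  fix \<phi> :: "real^'m \<Rightarrow> real" assume "test_function \<Omega> \<phi>"
  then have "C_k_on 1 UNIV \<phi>" by (simp add: test_function_def)
  then have diff: "\<phi> differentiable (at x)" and c0: "continuous_on UNIV \<phi>"
    and c1: "continuous_on UNIV (partial_derivs [j] \<phi>)" for x
    unfolding C_k_on_def by (auto dest: spec[of _ "[]"] spec[of _ "[j]"])
  have d\<phi>: "((\<lambda>s. \<phi> (x + s *\<^sub>R axis j 1)) has_real_derivative partial_derivs [j] \<phi> x) (at 0)" for x
    using has_vector_derivative_partial_derivs[of "[]" \<phi> x j] diff
    by (simp add: has_real_derivative_iff_has_vector_derivative)
  let ?H = "\<lambda>x. if x \<in> \<Omega> then h (v x t) else 0"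
  let ?W = "\<lambda>x. if x \<in> \<Omega> then k (v x t) * p j x t else 0"
  have cH: "continuous_on UNIV ?H"
    using continuous_cutoff_ext_at[OF eps cont_h vanish(2), of "\<lambda>_ _. 1" t] t
    by (simp add: case_prod_unfold cong: if_cong)
  have cW: "continuous_on UNIV ?W"
    by (rule continuous_cutoff_ext_at[OF eps cont_k vanish(1) cont_p t])
  have dH: "((\<lambda>s. ?H (x + s *\<^sub>R axis j 1)) has_real_derivative ?W x) (at 0)" for x
    using deriv_cutoff_ext[where \<Phi> = h and e = "axis j 1" and r = "\<lambda>_. 1" and x = x
          and f' = "\<lambda>x. k (v x t) * p j x t", OF eps vanish(2) t]
      deriv_truncated[OF _ t] by (simp cong: if_cong)
  obtain a b where ab: "\<Omega> \<subseteq> cbox a b"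
    using bounded_subset_cbox_symmetric[OF bounded_\<Omega>] by blast
  have "integral\<^sup>L (lebesgue_on \<Omega>) (\<lambda>x. partial_derivs [j] \<phi> x * ?H x + \<phi> x * ?W x) = 0"
  proof (rule integral_directional_derivative_eq_0[OF open_\<Omega> bounded_\<Omega>])
    show "continuous_on UNIV (\<lambda>x. \<phi> x * ?H x)"
      by (intro continuous_on_mult c0 cH)
    show "continuous_on UNIV (\<lambda>x. partial_derivs [j] \<phi> x * ?H x + \<phi> x * ?W x)"
      by (intro continuous_on_mult continuous_on_add c0 c1 cH cW)
    show "((\<lambda>s. \<phi> (x + s *\<^sub>R axis j 1) * ?H (x + s *\<^sub>R axis j 1)) has_real_derivative
           partial_derivs [j] \<phi> x * ?H x + \<phi> x * ?W x) (at 0)" for x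
      by (rule DERIV_cong[OF DERIV_mult[OF d\<phi>[of x] dH[of x]]]) simp
  qed auto
  moreover have "integrable (lebesgue_on \<Omega>) (\<lambda>x. partial_derivs [j] \<phi> x * ?H x)"
    by (rule lebesgue_on_open_zero_ext(1)[OF open_\<Omega> ab]) (intro continuous_on_mult c1 cH, simp)
  moreover have "integrable (lebesgue_on \<Omega>) (\<lambda>x. \<phi> x * ?W x)"
    by (rule lebesgue_on_open_zero_ext(1)[OF open_\<Omega> ab]) (intro continuous_on_mult c0 cW, simp)
  ultimately show "(LINT x|lebesgue_on \<Omega>. partial_derivs [j] \<phi> x *\<^sub>R ?H x) =
      (- 1) ^ length [j] *\<^sub>R (LINT x|lebesgue_on \<Omega>. \<phi> x *\<^sub>R ?W x)"
    by (simp only: Bochner_Integration.integral_add) simp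
qed

lemma L2_zero_ext:
  fixes f :: "real^'m \<Rightarrow> real"
  assumes "continuous_on UNIV f" "\<And>x. x \<notin> \<Omega> \<Longrightarrow> f x = 0"
  shows "L2_on \<Omega> f"
proof -
  obtain a b where ab: "\<Omega> \<subseteq> cbox a b"
    using bounded_subset_cbox_symmetric[OF bounded_\<Omega>] by blast
  have "integrable (lebesgue_on \<Omega>) (\<lambda>x. (norm (f x))\<^sup>2)"
    by (rule lebesgue_on_open_zero_ext(1)[OF open_\<Omega> ab])
       (use assms in \<open>auto intro!: continuous_intros\<close>)
  moreover have "integrable (lebesgue_on \<Omega>) f"
    by (rule lebesgue_on_open_zero_ext(1)[OF open_\<Omega> ab assms])
  ultimately show ?thesis by (auto simp: L2_on_def)
qed

text \<open>Poincare is applied to h(v) rather than to \<open>v\<close>, whose gradient is not known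
  here to be square integrable. The chain is: the integral of h^2 is controlled by that of (k
  \<open>p j\<close>)^2, this by that of k (\<open>p j\<close>)^2 because 0 \<le> k \<le> 1, and
  integration by parts turns the latter into the diffusion term.\<close>

lemma diffusion_estimate:
  assumes t: "t > 0" and \<kappa>: "poincare_constant \<Omega> \<kappa>"
  shows "integral\<^sup>L (lebesgue_on \<Omega>) (\<lambda>x. h (v x t) * (\<Sum>j\<in>UNIV. q j x t)) \<le>
         - \<kappa> * integral\<^sup>L (lebesgue_on \<Omega>) (\<lambda>x. (h (v x t))\<^sup>2)"
proof -
  let ?H = "\<lambda>x. if x \<in> \<Omega> then h (v x t) else 0"
  let ?W = "\<lambda>j x. if x \<in> \<Omega> then k (v x t) * p j x t else 0"
  have cH: "continuous_on UNIV ?H"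
    using continuous_cutoff_ext_at[OF eps cont_h vanish(2), of "\<lambda>_ _. 1" t] t
    by (simp add: case_prod_unfold cong: if_cong)
  have cW: "continuous_on UNIV (?W j)" for j
    by (rule continuous_cutoff_ext_at[OF eps cont_k vanish(1) cont_p t])
  have "L2_on \<Omega> ?H \<and> (\<forall>j. L2_on \<Omega> (?W j) \<and> has_weak_deriv \<Omega> [j] ?H (?W j)) \<and>
      continuous_on (closure \<Omega>) ?H \<and> (\<forall>x\<in>frontier \<Omega>. ?H x = 0)"
  proof (intro conjI allI ballI)
    show "L2_on \<Omega> ?H" by (rule L2_zero_ext[OF cH]) simp
    show "L2_on \<Omega> (?W j)" for j by (rule L2_zero_ext[OF cW]) simp
    show "has_weak_deriv \<Omega> [j] ?H (?W j)" for j by (rule weak_deriv_truncated[OF t])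
    show "continuous_on (closure \<Omega>) ?H" by (rule continuous_on_subset[OF cH]) simp
    show "?H x = 0" if "x \<in> frontier \<Omega>" for x
      using that open_\<Omega> by (simp add: frontier_def interior_open)
  qed
  then have "\<kappa> * (LINT x|lebesgue_on \<Omega>. (?H x)\<^sup>2) \<le> (LINT x|lebesgue_on \<Omega>. (\<Sum>j\<in>UNIV. (?W j x)\<^sup>2))"
    by (rule \<kappa>[unfolded poincare_constant_def, THEN conjunct2, THEN spec, THEN spec, THEN mp])
  also have "(LINT x|lebesgue_on \<Omega>. (?H x)\<^sup>2) = (LINT x|lebesgue_on \<Omega>. (h (v x t))\<^sup>2)"
    by (rule Bochner_Integration.integral_cong) auto
  also have "(LINT x|lebesgue_on \<Omega>. (\<Sum>j\<in>UNIV. (?W j x)\<^sup>2))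
      = (LINT x|lebesgue_on \<Omega>. (\<Sum>j\<in>UNIV. (k (v x t) * p j x t)\<^sup>2))"
    by (rule Bochner_Integration.integral_cong) auto
  also have "\<dots> \<le> (LINT x|lebesgue_on \<Omega>. (\<Sum>j\<in>UNIV. k (v x t) * (p j x t)\<^sup>2))"
  proof (rule integral_mono)
    fix x
    have "(k (v x t))\<^sup>2 \<le> k (v x t)"
      using k01[of "v x t"] by (simp add: power2_eq_square mult_left_le)
    then show "(\<Sum>j\<in>UNIV. (k (v x t) * p j x t)\<^sup>2) \<le> (\<Sum>j\<in>UNIV. k (v x t) * (p j x t)\<^sup>2)"
      by (intro sum_mono) (simp add: power_mult_distrib mult_right_mono)
  qed (use integrable_gradient_terms[OF t] in auto)
  also have "\<dots> = (\<Sum>j\<in>UNIV. LINT x|lebesgue_on \<Omega>. k (v x t) * (p j x t)\<^sup>2)"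
    using integrable_gradient_terms[OF t] by (intro Bochner_Integration.integral_sum) auto
  also have "\<dots> = - (\<Sum>j\<in>UNIV. LINT x|lebesgue_on \<Omega>. h (v x t) * q j x t)"
    using integration_by_parts[OF t] by (simp add: sum_negf)
  also have "(\<Sum>j\<in>UNIV. LINT x|lebesgue_on \<Omega>. h (v x t) * q j x t)
      = (LINT x|lebesgue_on \<Omega>. h (v x t) * (\<Sum>j\<in>UNIV. q j x t))"
    unfolding sum_distrib_left
    using integrable_gradient_terms[OF t] by (intro Bochner_Integration.integral_sum[symmetric]) auto
  finally show ?thesis by simp
qed

end

end

section \<open>The energy of a classical solution\<close>

lemma dirichlet_function_component:
  fixes u :: "real^'m::finite \<Rightarrow> real \<Rightarrow> real^'n::finite"
  assumes "open \<Omega>" "bounded \<Omega>" and sol: "classical_solution \<Omega> D F u0 u"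
  shows "dirichlet_function \<Omega> (\<lambda>x t. u x t $ i) (\<lambda>x t. vector_derivative (u x) (at t) $ i)
           (\<lambda>j x t. partial_derivs [j] (\<lambda>y. u y t) x $ i)
           (\<lambda>j x t. partial_derivs [j, j] (\<lambda>y. u y t) x $ i)"
proof
  note sol' = sol[unfolded classical_solution_def]
  have nth: "((\<lambda>s. f s $ i) has_real_derivative D $ i) (at s)"
    if "(f has_vector_derivative D) (at s)" for f :: "real \<Rightarrow> real^'n" and D s
    using bounded_linear.has_vector_derivative[OF bounded_linear_vec_nth that, of i]
    by (simp add: has_real_derivative_iff_has_vector_derivative)
  have cont: "continuous_on S (\<lambda>(x, t). f x t $ i)" if "continuous_on S (\<lambda>(x, t). f x t)"
    for S and f :: "real^'m \<Rightarrow> real \<Rightarrow> real^'n"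
    using continuous_on_component[OF that, of i] by (simp add: case_prod_unfold)
  have diff: "partial_derivs is (\<lambda>y. u y t) differentiable (at x)"
    if "x \<in> \<Omega>" "t > 0" "length is < 2" for x t "is"
    using sol' that unfolding C_k_on_def by blast
  show "continuous_on (closure \<Omega> \<times> {0..}) (\<lambda>(x, t). u x t $ i)"
    by (rule cont) (use sol' in blast)
  show "u x t $ i = 0" if "x \<in> frontier \<Omega>" "t \<ge> 0" for x t
    using sol' that by simp
  show "((\<lambda>t. u x t $ i) has_real_derivative vector_derivative (u x) (at t) $ i) (at t)"
    if "x \<in> \<Omega>" "t > 0" for x t
  proof (rule nth)
    have "u x differentiable (at t)" using sol' that by blast
    then show "(u x has_vector_derivative vector_derivative (u x) (at t)) (at t)"
      using vector_derivative_works by blast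
  qed
  show "continuous_on (\<Omega> \<times> {0<..}) (\<lambda>(x, t). vector_derivative (u x) (at t) $ i)"
    by (rule cont) (use sol' in blast)
  show "((\<lambda>s. u (x + s *\<^sub>R axis j 1) t $ i) has_real_derivative
      partial_derivs [j] (\<lambda>y. u y t) x $ i) (at 0)" if "x \<in> \<Omega>" "t > 0" for x t j
    using nth[OF has_vector_derivative_partial_derivs[OF diff[OF that, of "[]"], of j]] by simp
  show "continuous_on (\<Omega> \<times> {0<..}) (\<lambda>(x, t). partial_derivs [j] (\<lambda>y. u y t) x $ i)" for j
    by (rule cont) (use sol' in \<open>auto simp del: partial_derivs.simps\<close>)
  show "((\<lambda>s. partial_derivs [j] (\<lambda>y. u y t) (x + s *\<^sub>R axis j 1) $ i) has_real_derivative
      partial_derivs [j, j] (\<lambda>y. u y t) x $ i) (at 0)" if "x \<in> \<Omega>" "t > 0" for x t j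
    by (rule nth[OF has_vector_derivative_partial_derivs[OF diff[OF that]]]) simp
  show "continuous_on (\<Omega> \<times> {0<..}) (\<lambda>(x, t). partial_derivs [j, j] (\<lambda>y. u y t) x $ i)" for j
    by (rule cont) (use sol' in \<open>auto simp del: partial_derivs.simps\<close>)
qed (use assms in auto)

lemma norm_sq_vec: "(norm (v :: real^'n))\<^sup>2 = (\<Sum>i\<in>UNIV. (v $ i)\<^sup>2)"
  by (simp add: norm_vec_def L2_set_def sum_nonneg)

context
  fixes \<Omega> :: "(real^'m::finite) set" and D :: "real \<Rightarrow> real^'n^'n::finite"
    and F :: "real^'n \<Rightarrow> real^'m \<Rightarrow> real \<Rightarrow> real^'n" and u0 u
  assumes op: "open \<Omega>" and bdd: "bounded \<Omega>" and sol: "classical_solution \<Omega> D F u0 u"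
begin

lemma integrable_component_sq:
  assumes "t \<ge> 0"
  shows "integrable (lebesgue_on \<Omega>) (\<lambda>x. (u x t $ i)\<^sup>2)"
  using dirichlet_function.integrable_comp[OF dirichlet_function_component[OF op bdd sol, of i],
      of "\<lambda>s. s\<^sup>2" t] assms by (simp add: continuous_on_power)

lemma integrable_norm_sq:
  assumes "t \<ge> 0"
  shows "integrable (lebesgue_on \<Omega>) (\<lambda>x. (norm (u x t))\<^sup>2)"
  unfolding norm_sq_vec using integrable_component_sq[OF assms] by auto

lemma integral_norm_sq:
  assumes "t \<ge> 0"
  shows "(LINT x|lebesgue_on \<Omega>. (norm (u x t))\<^sup>2) = (\<Sum>i\<in>UNIV. LINT x|lebesgue_on \<Omega>. (u x t $ i)\<^sup>2)"
  unfolding norm_sq_vec using integrable_component_sq[OF assms]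
  by (intro Bochner_Integration.integral_sum) auto

lemma continuous_energy: "continuous_on {0..} (\<lambda>t. LINT x|lebesgue_on \<Omega>. (norm (u x t))\<^sup>2)"
proof -
  have "continuous_on {0..} (\<lambda>t. \<Sum>i\<in>UNIV. LINT x|lebesgue_on \<Omega>. (u x t $ i)\<^sup>2)"
    by (intro continuous_on_sum
        dirichlet_function.continuous_integral_comp[OF dirichlet_function_component[OF op bdd sol]])
       (auto intro!: continuous_intros)
  then show ?thesis
    by (rule continuous_on_eq) (simp add: integral_norm_sq)
qed

lemma integral_bound:
  assumes "\<And>x. x \<in> \<Omega> \<Longrightarrow> f x \<le> b" "integrable (lebesgue_on \<Omega>) f"
  shows "(LINT x|lebesgue_on \<Omega>. f x) \<le> b * measure lebesgue \<Omega>"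
proof -
  have lm: "\<Omega> \<in> lmeasurable" using op bdd by (simp add: lmeasurable_open)
  have "(LINT x|lebesgue_on \<Omega>. f x) \<le> (LINT x|lebesgue_on \<Omega>. b)"
    using assms lm by (intro integral_mono) (auto intro: finite_measure.integrable_const finite_measure_lebesgue_on)
  also have "\<dots> = b * measure lebesgue \<Omega>"
    using lm by (simp add: measure_restrict_space)
  finally show ?thesis .
qed

lemma truncated_energy_close:
  assumes tr: "truncation \<epsilon> k h G" and t: "t > 0" and bound: "\<And>x. x \<in> \<Omega> \<Longrightarrow> norm (u x t) \<le> M"
  shows "\<bar>(\<Sum>i\<in>UNIV. 2 * (LINT x|lebesgue_on \<Omega>. G (u x t $ i))) - (LINT x|lebesgue_on \<Omega>. (norm (u x t))\<^sup>2)\<bar>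
          \<le> 4 * real CARD('n) * M * measure lebesgue \<Omega> * \<epsilon>"
proof -
  note dir = dirichlet_function_component[OF op bdd sol]
  have \<epsilon>: "\<epsilon> > 0" using tr by (simp add: truncation_def)
  have iG: "integrable (lebesgue_on \<Omega>) (\<lambda>x. G (u x t $ i))" for i
    using dirichlet_function.integrable_comp[OF dir dirichlet_function.cont_G[OF dir tr], of t i]
      dirichlet_function.vanish(3)[OF dir tr, of 0] \<epsilon> t by simp
  note iu = integrable_component_sq[of t]
  have one: "\<bar>2 * (LINT x|lebesgue_on \<Omega>. G (u x t $ i)) - (LINT x|lebesgue_on \<Omega>. (u x t $ i)\<^sup>2)\<bar>
      \<le> 4 * \<epsilon> * M * measure lebesgue \<Omega>" for i
  proof -
    have "\<bar>2 * (LINT x|lebesgue_on \<Omega>. G (u x t $ i)) - (LINT x|lebesgue_on \<Omega>. (u x t $ i)\<^sup>2)\<bar>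
        = \<bar>LINT x|lebesgue_on \<Omega>. 2 * G (u x t $ i) - (u x t $ i)\<^sup>2\<bar>"
      using iG iu t by simp
    also have "\<dots> \<le> (LINT x|lebesgue_on \<Omega>. \<bar>2 * G (u x t $ i) - (u x t $ i)\<^sup>2\<bar>)"
      by (rule integral_abs_bound)
    also have "\<dots> \<le> 4 * \<epsilon> * M * measure lebesgue \<Omega>"
    proof (rule integral_bound)
      fix x assume "x \<in> \<Omega>"
      then have "\<bar>u x t $ i\<bar> \<le> M" using bound component_le_norm_cart order_trans by blast
      then have "4 * \<epsilon> * \<bar>u x t $ i\<bar> \<le> 4 * \<epsilon> * M" using \<epsilon> by (intro mult_left_mono) auto
      then show "\<bar>2 * G (u x t $ i) - (u x t $ i)\<^sup>2\<bar> \<le> 4 * \<epsilon> * M"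
        using tr unfolding truncation_def by (meson order_trans)
    qed (use iG iu t in auto)
    finally show ?thesis .
  qed
  have "\<bar>(\<Sum>i\<in>UNIV. 2 * (LINT x|lebesgue_on \<Omega>. G (u x t $ i))) - (LINT x|lebesgue_on \<Omega>. (norm (u x t))\<^sup>2)\<bar>
      = \<bar>\<Sum>i\<in>UNIV. 2 * (LINT x|lebesgue_on \<Omega>. G (u x t $ i)) - (LINT x|lebesgue_on \<Omega>. (u x t $ i)\<^sup>2)\<bar>"
    using t by (simp add: integral_norm_sq sum_subtractf)
  also have "\<dots> \<le> (\<Sum>i\<in>(UNIV :: 'n set). 4 * \<epsilon> * M * measure lebesgue \<Omega>)"
    using one by (intro order_trans[OF sum_abs] sum_mono)
  finally show ?thesis by (simp add: mult_ac)
qed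

text \<open>\<open>\<delta>\<close> is the amount of diffusion actually exploited and
  \<open>m\<close> a growth rate of the reaction; both stay free so that they can be chosen
  separately at each time. The error involves \<open>\<delta>\<close> and not the entries of
  \<open>D\<close>: 8 \<open>\<delta>\<close> \<open>\<kappa>\<close> \<open>M\<close> comes from
  replacing h(u)^2 by u^2 - 4\<epsilon>|u| in the dissipation, and 4 \<open>M1\<close> from
  replacing h(u) by u against \<open>F\<close>.\<close>

lemma truncated_energy_derivative:
  assumes tr: "truncation \<epsilon> k h G" and t: "t > 0" and bound: "\<And>x. x \<in> \<Omega> \<Longrightarrow> norm (u x t) \<le> M"
    and \<kappa>: "poincare_constant \<Omega> \<kappa>"
    and diag: "\<And>i j. i \<noteq> j \<Longrightarrow> D t $ i $ j = 0" and \<delta>: "0 \<le> \<delta>" "\<And>i. \<delta> \<le> D t $ i $ i"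
    and FM: "\<And>x. x \<in> \<Omega> \<Longrightarrow> norm (F (u x t) x t) \<le> M1"
    and Fu: "AE x in lebesgue_on \<Omega>. F (u x t) x t \<bullet> u x t \<le> m * (norm (u x t))\<^sup>2"
  shows "\<exists>E'. ((\<lambda>t. \<Sum>i\<in>UNIV. 2 * (LINT x|lebesgue_on \<Omega>. G (u x t $ i))) has_real_derivative E') (at t) \<and>
          E' \<le> 2 * ((m - \<delta> * \<kappa>) * (LINT x|lebesgue_on \<Omega>. (norm (u x t))\<^sup>2))
             + (8 * (\<delta> * \<kappa>) * M + 4 * M1) * CARD('n) * measure lebesgue \<Omega> * \<epsilon>"
proof -
  note dir = dirichlet_function_component[OF op bdd sol]
  have \<epsilon>: "\<epsilon> > 0" and near: "\<And>s. \<bar>h s - s\<bar> \<le> 2 * \<epsilon>" using tr by (auto simp: truncation_def)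
  have \<kappa>0: "\<kappa> > 0" using \<kappa> by (simp add: poincare_constant_def)
  have t0: "t \<ge> 0" using t by simp
  define u' where "u' x = vector_derivative (u x) (at t)" for x
  define lap where "lap x = laplacian (\<lambda>y. u y t) x" for x
  define f where "f x = F (u x t) x t" for x
  have pde: "u' x $ i = D t $ i $ i * lap x $ i + f x $ i" if "x \<in> \<Omega>" for x i
  proof -
    have "u' x = D t *v lap x + f x"
      using sol that t unfolding classical_solution_def u'_def lap_def f_def by blast
    moreover have "(D t *v lap x) $ i = D t $ i $ i * lap x $ i"
      unfolding matrix_vector_mult_def using diag
      by (simp add: sum.remove[of UNIV i])
    ultimately show ?thesis by simp
  qed
  have lap_nth: "lap x $ i = (\<Sum>j\<in>UNIV. partial_derivs [j, j] (\<lambda>y. u y t) x $ i)" for x i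
    unfolding lap_def laplacian_def by (simp only: sum_component)
  have ilap: "integrable (lebesgue_on \<Omega>) (\<lambda>x. h (u x t $ i) * lap x $ i)" for i
    unfolding lap_nth sum_distrib_left
    using dirichlet_function.integrable_gradient_terms(3)[OF dir tr t, of i]
    by (intro Bochner_Integration.integrable_sum) auto
  have iu': "integrable (lebesgue_on \<Omega>) (\<lambda>x. h (u x t $ i) * u' x $ i)" for i
    unfolding u'_def
    using dirichlet_function.integrable_cutoff[OF dir \<epsilon> dirichlet_function.cont_h[OF dir tr]
        dirichlet_function.vanish(2)[OF dir tr] dirichlet_function.cont_v'[OF dir] t] .
  \<comment> \<open>Integrability of the reaction term is read off the equation, as a difference of
    the time derivative and diffusion terms, both of which are cut off near the boundary.\<close>
  have if': "integrable (lebesgue_on \<Omega>) (\<lambda>x. h (u x t $ i) * f x $ i)" for i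
  proof -
    have "integrable (lebesgue_on \<Omega>) (\<lambda>x. h (u x t $ i) * u' x $ i - D t $ i $ i * (h (u x t $ i) * lap x $ i))"
      using ilap iu' by auto
    then show ?thesis
      by (rule Bochner_Integration.integrable_cong[THEN iffD1, rotated 2]) (simp_all add: pde algebra_simps)
  qed
  have ih: "integrable (lebesgue_on \<Omega>) (\<lambda>x. (h (u x t $ i))\<^sup>2)" for i
    using dirichlet_function.integrable_comp[OF dir _ _ t0, of "\<lambda>s. (h s)\<^sup>2" i]
      dirichlet_function.vanish(2)[OF dir tr, of 0] dirichlet_function.cont_h[OF dir tr] \<epsilon>
    by (simp add: continuous_on_power)
  have iabs: "integrable (lebesgue_on \<Omega>) (\<lambda>x. \<bar>u x t $ i\<bar>)" for i
    using dirichlet_function.integrable_comp[OF dir _ _ t0, of "\<lambda>s. \<bar>s\<bar>" i]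
    by (simp add: continuous_on_rabs)
  define E' where "E' = (\<Sum>i\<in>UNIV. 2 * (LINT x|lebesgue_on \<Omega>. h (u x t $ i) * u' x $ i))"
  have deriv: "((\<lambda>t. \<Sum>i\<in>UNIV. 2 * (LINT x|lebesgue_on \<Omega>. G (u x t $ i))) has_real_derivative E') (at t)"
    unfolding E'_def u'_def
    by (intro DERIV_sum DERIV_cmult dirichlet_function.deriv_energy[OF dir tr t])
  let ?N = "measure lebesgue \<Omega>"
  \<comment> \<open>The dissipation -\<open>\<kappa>\<close> \<open>?J\<close> is nonpositive, so
    the diagonal entry may be lowered to \<open>\<delta>\<close> before the error in
    \<open>?J\<close> is estimated; otherwise that error would scale with the entry. The lower bound
    for \<open>?J\<close> expands h = s + (h - s) and drops the square of h - s.\<close>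
  have diffusion: "D t $ i $ i * (LINT x|lebesgue_on \<Omega>. h (u x t $ i) * lap x $ i)
      \<le> - (\<delta> * \<kappa>) * (LINT x|lebesgue_on \<Omega>. (u x t $ i)\<^sup>2) + \<delta> * \<kappa> * (4 * \<epsilon> * (M * ?N))" for i
  proof -
    let ?J = "LINT x|lebesgue_on \<Omega>. (h (u x t $ i))\<^sup>2"
    have "(LINT x|lebesgue_on \<Omega>. h (u x t $ i) * lap x $ i) \<le> - \<kappa> * ?J"
      unfolding lap_nth by (rule dirichlet_function.diffusion_estimate[OF dir tr t \<kappa>])
    then have "D t $ i $ i * (LINT x|lebesgue_on \<Omega>. h (u x t $ i) * lap x $ i) \<le> D t $ i $ i * (- \<kappa> * ?J)"
      using \<delta> order_trans by (intro mult_left_mono) blast+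
    also have "\<dots> \<le> - (\<delta> * \<kappa>) * ?J"
      using \<delta>(2)[of i] \<kappa>0 by (simp add: mult_right_mono)
    also have "\<dots> \<le> - (\<delta> * \<kappa>) * ((LINT x|lebesgue_on \<Omega>. (u x t $ i)\<^sup>2) - 4 * \<epsilon> * (M * ?N))"
    proof (rule mult_left_mono_neg)
      have "(LINT x|lebesgue_on \<Omega>. \<bar>u x t $ i\<bar>) \<le> M * ?N"
        using bound component_le_norm_cart order_trans by (intro integral_bound iabs) blast
      then have "(LINT x|lebesgue_on \<Omega>. (u x t $ i)\<^sup>2) - 4 * \<epsilon> * (M * ?N)
          \<le> (LINT x|lebesgue_on \<Omega>. (u x t $ i)\<^sup>2) - 4 * \<epsilon> * (LINT x|lebesgue_on \<Omega>. \<bar>u x t $ i\<bar>)"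
        using \<epsilon> by simp
      also have "\<dots> = (LINT x|lebesgue_on \<Omega>. (u x t $ i)\<^sup>2 - 4 * \<epsilon> * \<bar>u x t $ i\<bar>)"
        using integrable_component_sq[OF t0] iabs by simp
      also have "\<dots> \<le> ?J"
      proof (rule integral_mono)
        fix x
        let ?s = "u x t $ i"
        have "\<bar>2 * ?s * (h ?s - ?s)\<bar> \<le> 2 * \<bar>?s\<bar> * (2 * \<epsilon>)"
          unfolding abs_mult using near[of ?s] by (intro mult_mono) auto
        then have "- (4 * \<epsilon> * \<bar>?s\<bar>) \<le> 2 * ?s * (h ?s - ?s)"
          unfolding abs_le_iff by (simp only: mult_ac) linarith
        moreover have "(h ?s)\<^sup>2 = ?s\<^sup>2 + 2 * ?s * (h ?s - ?s) + (h ?s - ?s)\<^sup>2"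
          by (simp add: power2_eq_square algebra_simps)
        moreover have "(h ?s - ?s)\<^sup>2 \<ge> 0" by simp
        ultimately show "?s\<^sup>2 - 4 * \<epsilon> * \<bar>?s\<bar> \<le> (h ?s)\<^sup>2"
          by linarith
      qed (use integrable_component_sq[OF t0] iabs ih in auto)
      finally show "(LINT x|lebesgue_on \<Omega>. (u x t $ i)\<^sup>2) - 4 * \<epsilon> * (M * ?N) \<le> ?J" .
    qed (use \<delta> \<kappa>0 in simp)
    finally show ?thesis by (simp add: algebra_simps)
  qed
  have lm: "\<Omega> \<in> lmeasurable" using op bdd by (simp add: lmeasurable_open)
  \<comment> \<open>The sum over components stays under the integral, since the growth bound
    concerns the full inner product of \<open>F\<close> with \<open>u\<close> and not its single
    terms.\<close>
  have reaction: "(LINT x|lebesgue_on \<Omega>. (\<Sum>i\<in>UNIV. h (u x t $ i) * f x $ i))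
      \<le> m * (LINT x|lebesgue_on \<Omega>. (norm (u x t))\<^sup>2) + 2 * \<epsilon> * M1 * CARD('n) * ?N"
  proof -
    have "(LINT x|lebesgue_on \<Omega>. (\<Sum>i\<in>UNIV. h (u x t $ i) * f x $ i))
        \<le> (LINT x|lebesgue_on \<Omega>. m * (norm (u x t))\<^sup>2 + 2 * \<epsilon> * M1 * CARD('n))"
    proof (rule integral_mono_AE)
      have "AE x in lebesgue_on \<Omega>. x \<in> \<Omega>" using AE_space[of "lebesgue_on \<Omega>"] by simp
      with Fu show "AE x in lebesgue_on \<Omega>. (\<Sum>i\<in>UNIV. h (u x t $ i) * f x $ i)
          \<le> m * (norm (u x t))\<^sup>2 + 2 * \<epsilon> * M1 * CARD('n)"
      proof eventually_elim
        case (elim x)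
        have "(\<Sum>i\<in>UNIV. (h (u x t $ i) - u x t $ i) * f x $ i) \<le> (\<Sum>i\<in>(UNIV :: 'n set). 2 * \<epsilon> * M1)"
        proof (rule sum_mono)
          fix i
          have "\<bar>f x $ i\<bar> \<le> M1"
            using FM[OF elim(2)] component_le_norm_cart[of "f x" i] by (simp add: f_def)
          then have "\<bar>(h (u x t $ i) - u x t $ i) * f x $ i\<bar> \<le> 2 * \<epsilon> * M1"
            unfolding abs_mult using near[of "u x t $ i"] \<epsilon> by (intro mult_mono) auto
          then show "(h (u x t $ i) - u x t $ i) * f x $ i \<le> 2 * \<epsilon> * M1" by simp
        qed
        moreover have "(\<Sum>i\<in>UNIV. h (u x t $ i) * f x $ i)
            = f x \<bullet> u x t + (\<Sum>i\<in>UNIV. (h (u x t $ i) - u x t $ i) * f x $ i)"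
          by (simp add: inner_vec_def sum.distrib[symmetric] algebra_simps)
        ultimately show ?case using elim(1) by (simp add: f_def mult_ac)
      qed
    qed (use if' integrable_norm_sq[OF t0] lm in
        \<open>auto intro!: Bochner_Integration.integrable_add Bochner_Integration.integrable_sum
           intro: finite_measure.integrable_const finite_measure_lebesgue_on\<close>)
    also have "\<dots> = m * (LINT x|lebesgue_on \<Omega>. (norm (u x t))\<^sup>2) + 2 * \<epsilon> * M1 * CARD('n) * ?N"
      using integrable_norm_sq[OF t0] lm
      by (subst Bochner_Integration.integral_add)
         (auto simp: measure_restrict_space intro: finite_measure.integrable_const finite_measure_lebesgue_on)
    finally show ?thesis .
  qed
  have split: "(LINT x|lebesgue_on \<Omega>. h (u x t $ i) * u' x $ i) =
      D t $ i $ i * (LINT x|lebesgue_on \<Omega>. h (u x t $ i) * lap x $ i)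
      + (LINT x|lebesgue_on \<Omega>. h (u x t $ i) * f x $ i)" for i
  proof -
    have "(LINT x|lebesgue_on \<Omega>. h (u x t $ i) * u' x $ i) =
        (LINT x|lebesgue_on \<Omega>. D t $ i $ i * (h (u x t $ i) * lap x $ i) + h (u x t $ i) * f x $ i)"
      by (rule Bochner_Integration.integral_cong) (simp_all add: pde algebra_simps)
    also have "\<dots> = D t $ i $ i * (LINT x|lebesgue_on \<Omega>. h (u x t $ i) * lap x $ i)
        + (LINT x|lebesgue_on \<Omega>. h (u x t $ i) * f x $ i)"
      using ilap[of i] if'[of i] by simp
    finally show ?thesis .
  qed
  have "E' = 2 * ((\<Sum>i\<in>UNIV. D t $ i $ i * (LINT x|lebesgue_on \<Omega>. h (u x t $ i) * lap x $ i))
      + (LINT x|lebesgue_on \<Omega>. (\<Sum>i\<in>UNIV. h (u x t $ i) * f x $ i)))"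
    using if' unfolding E'_def split sum_distrib_left[symmetric]
    by (simp add: sum.distrib Bochner_Integration.integral_sum)
  also have "\<dots> \<le> 2 * ((\<Sum>i\<in>UNIV. - (\<delta> * \<kappa>) * (LINT x|lebesgue_on \<Omega>. (u x t $ i)\<^sup>2) + \<delta> * \<kappa> * (4 * \<epsilon> * (M * ?N)))
      + (m * (LINT x|lebesgue_on \<Omega>. (norm (u x t))\<^sup>2) + 2 * \<epsilon> * M1 * CARD('n) * ?N))"
    using diffusion reaction by (intro mult_left_mono add_mono sum_mono) auto
  also have "\<dots> = 2 * ((m - \<delta> * \<kappa>) * (LINT x|lebesgue_on \<Omega>. (norm (u x t))\<^sup>2))
      + (8 * (\<delta> * \<kappa>) * M + 4 * M1) * CARD('n) * ?N * \<epsilon>"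
    unfolding sum.distrib sum_distrib_left[symmetric] integral_norm_sq[OF t0]
    by (simp add: algebra_simps)
  finally show ?thesis using deriv by blast
qed

end

section \<open>Growth rates, comparison with the barrier, and exponential decay\<close>

theorem theorem3p1:
  fixes \<Omega> :: "(real^'m::finite) set"
    and D :: "real \<Rightarrow> real^'n^'n::finite"
    and A :: "real^'m \<Rightarrow> real \<Rightarrow> real^'n^'n"
    and B F :: "real^'n \<Rightarrow> real^'m \<Rightarrow> real \<Rightarrow> real^'n"
    and u0 :: "real^'m \<Rightarrow> real^'n"
    and u :: "real^'m \<Rightarrow> real \<Rightarrow> real^'n"
    and d \<gamma> c0 \<sigma> \<alpha> g C :: "real \<Rightarrow> real"
    and M1 cF c c\<Omega> p \<sigma>0 :: real
  assumes "CARD('m) \<le> 3"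
    and "open \<Omega>" "connected \<Omega>" "\<Omega> \<noteq> {}" "bounded \<Omega>" "C_k_boundary 2 \<Omega>"
    and "\<And>t i j. t \<ge> 0 \<Longrightarrow> i \<noteq> j \<Longrightarrow> D t $ i $ j = 0"
    and "\<And>t i. t \<ge> 0 \<Longrightarrow> D t $ i $ i > 0"
    and "\<And>t i. t \<ge> 0 \<Longrightarrow> D t $ i $ i \<ge> d t"
    and "\<And>t. t \<ge> 0 \<Longrightarrow> d t > 0"
    and "\<And>v x t. F v x t = A x t *v v + B v x t"
    and "\<And>x t. x \<in> \<Omega> \<Longrightarrow> t \<ge> 0 \<Longrightarrow> F 0 x t = 0"
    and "\<And>v x t. t \<ge> 0 \<Longrightarrow> norm (F v x t) \<le> M1"
    and "cF > 0"
    and "\<And>v w x t s. t \<ge> 0 \<Longrightarrow> s \<ge> 0 \<Longrightarrow>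
           norm (F v x t - F w x s) \<le> cF * (\<bar>t - s\<bar> + norm (v - w))"
    and "\<And>v t. t \<ge> 0 \<Longrightarrow> continuous_on UNIV (\<lambda>x. F v x t)"
    and "\<And>v x t. x \<in> \<Omega> \<Longrightarrow> t \<ge> 0 \<Longrightarrow> (A x t *v v) \<bullet> v \<le> - \<gamma> t * (norm v)\<^sup>2"
    and "p = 2"
    and "\<And>v x t. x \<in> \<Omega> \<Longrightarrow> t \<ge> 0 \<Longrightarrow> norm (B v x t) \<le> c0 t * norm v powr p"
    and "\<And>x. x \<in> frontier \<Omega> \<Longrightarrow> u0 x = 0"
    and "classical_solution \<Omega> D F u0 u"
    and "\<And>t. t \<ge> 0 \<Longrightarrow> sobolev_H 2 \<Omega> (\<lambda>x. u x t)"
    and "\<And>t. g t = L2_norm_on \<Omega> (\<lambda>x. u x t)"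
    and "g 0 \<noteq> 0"
    and "poincare_constant \<Omega> c\<Omega>"
    and "c > 0"
    and "\<And>v :: real^'m \<Rightarrow> real^'n. sobolev_H 2 \<Omega> v \<Longrightarrow>
           esssup (lebesgue_on \<Omega>) (\<lambda>x. ereal (norm (v x))) \<le>
           ereal (c * L2_norm_on \<Omega> v powr (1/4) * sobolev_norm 2 \<Omega> v powr (3/4))"
    and "\<And>t. \<sigma> t = d t * c\<Omega> + \<gamma> t"
    and "continuous_on {0..} \<sigma>"
    and "\<And>t. \<alpha> t = c0 t * c powr (p - 1) * sobolev_norm 2 \<Omega> (\<lambda>x. u x t) powr (3 * (p - 1) / 4)"
    and "continuous_on {0..} \<alpha>"
    and "\<And>t. t \<ge> 0 \<Longrightarrow> \<alpha> t \<ge> 0"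
    and "\<sigma>0 > 0"
    and "\<And>t. t \<ge> 0 \<Longrightarrow> \<sigma> t \<ge> \<sigma>0"
    and "\<And>t. C t = c * sobolev_norm 2 \<Omega> (\<lambda>x. u x t) powr (3/4)"
    and "\<And>t. t \<ge> 0 \<Longrightarrow> c0 t * C t \<le> 1/2 * g 0 powr (-1/4) * exp (1/8 * \<sigma>0 * t) * \<sigma>0"
  shows "\<forall>t\<ge>0. L2_norm_on \<Omega> (\<lambda>x. u x t) \<le> g 0 * exp (- (1/2) * \<sigma>0 * t)"
proof -
  note op = assms(2) and ne = assms(4) and bdd = assms(5) and diag = assms(7)
    and Dd = assms(9) and dpos = assms(10) and F_eq = assms(11) and F0 = assms(12) and FM = assms(13)
    and FL = assms(15) and A_le = assms(17) and p2 = assms(18) and B_le = assms(19)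
    and sol = assms(21) and sob = assms(22) and g_def = assms(23) and g0 = assms(24)
    and poin = assms(25) and c_pos = assms(26) and interp = assms(27) and sigma_def = assms(28)
    and sigma0 = assms(33) and sigma_ge = assms(34) and C_def = assms(35) and small = assms(36)
  define y where "y t = (LINT x|lebesgue_on \<Omega>. (norm (u x t))\<^sup>2)" for t
  have y_nonneg: "y t \<ge> 0" for t unfolding y_def by simp
  have g_sqrt: "g t = sqrt (y t)" for t unfolding g_def L2_norm_on_def y_def ..
  have g_nonneg: "g t \<ge> 0" and g_sq: "(g t)\<^sup>2 = y t" for t
    unfolding g_sqrt using y_nonneg by auto
  have g0_pos: "g 0 > 0" using g0 g_nonneg[of 0] by simp
  have y0_pos: "y 0 > 0" using g0_pos g_sq[of 0] by (metis zero_less_power)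
  have \<kappa>_pos: "c\<Omega> > 0" using poin by (simp add: poincare_constant_def)
  obtain x0 where x0: "x0 \<in> \<Omega>" using ne by blast
  have M1_nonneg: "M1 \<ge> 0" using FM[of 0 0 x0] norm_ge_zero order_trans by blast
  \<comment> \<open>The growth bound on \<open>B\<close> is evaluated at a unit vector, where the
    power equals 1; \<open>undefined\<close> is just some index.\<close>
  have c0_nonneg: "c0 t \<ge> 0" if "t \<ge> 0" for t
  proof -
    have "0 \<le> norm (B (axis undefined 1) x0 t)" by simp
    also have "\<dots> \<le> c0 t" using B_le[OF x0 that, of "axis undefined 1"] by simp
    finally show ?thesis .
  qed
  have C_nonneg: "C t \<ge> 0" for t using c_pos by (simp add: C_def)
  \<comment> \<open>The growth rate due to \<open>B\<close>: for p = 2 its inner product with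
    \<open>u\<close> is at most \<open>c0 t\<close> |u|^3, and the interpolation inequality bounds
    one factor |u| by \<open>C t * g t powr (1/4)\<close>. As it bounds an essential supremum, the
    estimate below holds almost everywhere only.\<close>
  define \<beta> where "\<beta> t = c0 t * C t * g t powr (1/4)" for t
  have \<beta>_nonneg: "\<beta> t \<ge> 0" if "t \<ge> 0" for t
    using c0_nonneg[OF that] C_nonneg by (simp add: \<beta>_def)

  have reaction: "AE x in lebesgue_on \<Omega>. F (u x t) x t \<bullet> u x t \<le> (- \<gamma> t + \<beta> t) * (norm (u x t))\<^sup>2"
    if t: "t \<ge> 0" for t
  proof -
    have "AE x in lebesgue_on \<Omega>. x \<in> \<Omega>" using AE_space[of "lebesgue_on \<Omega>"] by simp
    moreover have "AE x in lebesgue_on \<Omega>. ereal (norm (u x t)) \<le> esssup (lebesgue_on \<Omega>) (\<lambda>x. ereal (norm (u x t)))"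
      by (rule esssup_AE)
    ultimately show ?thesis
    proof eventually_elim
      case (elim x)
      have "ereal (norm (u x t)) \<le> ereal (c * L2_norm_on \<Omega> (\<lambda>x. u x t) powr (1/4)
          * sobolev_norm 2 \<Omega> (\<lambda>x. u x t) powr (3/4))"
        using elim(2) interp[OF sob[OF t]] by (rule order_trans)
      then have sup: "norm (u x t) \<le> C t * g t powr (1/4)"
        by (simp add: C_def g_def mult_ac)
      have "B (u x t) x t \<bullet> u x t \<le> norm (B (u x t) x t) * norm (u x t)"
        by (rule norm_cauchy_schwarz)
      also have "\<dots> \<le> (c0 t * norm (u x t) powr p) * norm (u x t)"
        by (intro mult_right_mono B_le elim t) simp
      also have "\<dots> = (c0 t * norm (u x t)) * (norm (u x t))\<^sup>2"
        by (simp add: p2 power2_eq_square)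
      also have "\<dots> \<le> \<beta> t * (norm (u x t))\<^sup>2"
        unfolding \<beta>_def mult.assoc[of "c0 t"] using sup c0_nonneg[OF t]
        by (intro mult_right_mono mult_left_mono) auto
      finally show ?case
        using A_le[OF elim(1) t, of "u x t"] by (simp add: F_eq inner_add_left algebra_simps)
    qed
  qed
  \<comment> \<open>A second growth rate, constant in time, from the Lipschitz bound and
    \<open>F 0 x t = 0\<close>. It takes over at times when \<open>d t\<close> is large.\<close>
  have reaction': "F (u x t) x t \<bullet> u x t \<le> cF * (norm (u x t))\<^sup>2" if "x \<in> \<Omega>" "t \<ge> 0" for x t
  proof -
    have "norm (F (u x t) x t) \<le> cF * norm (u x t)"
      using FL[OF that(2) that(2), of "u x t" x 0] F0[OF that] by simp
    then have "norm (F (u x t) x t) * norm (u x t) \<le> cF * norm (u x t) * norm (u x t)"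
      by (intro mult_right_mono) auto
    then show ?thesis
      using norm_cauchy_schwarz[of "F (u x t) x t" "u x t"] by (simp add: power2_eq_square mult_ac)
  qed

  \<comment> \<open>Solves \<open>cF - \<Delta> * c\<Omega> = - \<sigma>0\<close>: this much
    diffusion beats the Lipschitz growth by \<open>\<sigma>0\<close>. A cap on the diffusion used is
    essential because the truncation error is proportional to it and has to be O(\<epsilon>)
    uniformly in t.\<close>
  define \<Delta> where "\<Delta> = (\<sigma>0 + cF) / c\<Omega>"
  \<comment> \<open>\<open>d\<close> need not be locally bounded. Where it is large, the Lipschitz bound on \<open>F\<close> already
    suffices, so that a bounded part \<open>\<delta>\<close> of the diffusion is enough.\<close>
  have balance: "\<exists>\<delta> m. 0 \<le> \<delta> \<and> \<delta> \<le> \<Delta> \<and> (\<forall>i. \<delta> \<le> D t $ i $ i) \<and> m - \<delta> * c\<Omega> \<le> - \<sigma>0 + \<beta> t \<and>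
      (AE x in lebesgue_on \<Omega>. F (u x t) x t \<bullet> u x t \<le> m * (norm (u x t))\<^sup>2)" if t: "t \<ge> 0" for t
  proof (cases "d t \<le> \<Delta>")
    case True
    then show ?thesis
      using dpos[OF t] Dd[OF t] reaction[OF t] sigma_ge[OF t] sigma_def[of t]
      by (intro exI[of _ "d t"] exI[of _ "- \<gamma> t + \<beta> t"]) auto
  next
    case False
    have "AE x in lebesgue_on \<Omega>. F (u x t) x t \<bullet> u x t \<le> cF * (norm (u x t))\<^sup>2"
      using reaction'[OF _ t] by (intro AE_I2) simp
    moreover have "\<Delta> * c\<Omega> = \<sigma>0 + cF" using \<kappa>_pos by (simp add: \<Delta>_def)
    moreover have "\<Delta> \<le> D t $ i $ i" for i using False Dd[OF t, of i] by simp
    moreover have "\<Delta> \<ge> 0" using \<kappa>_pos sigma0 \<open>cF > 0\<close> by (simp add: \<Delta>_def)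
    ultimately show ?thesis
      using \<beta>_nonneg[OF t] by (intro exI[of _ \<Delta>] exI[of _ cF]) auto
  qed

  have \<beta>_le: "\<beta> t \<le> \<sigma>0 / 2 * (y t * exp (\<sigma>0 * t) / y 0)"
    if t: "t \<ge> 0" and large: "y t \<ge> y 0 * exp (- \<sigma>0 * t)" for t
  proof -
    \<comment> \<open>The ratio of \<open>g\<close> to the barrier. Smallness gives
      \<open>\<beta> t \<le> \<sigma>0 / 2 * \<omega> powr (1/4)\<close>, and since
      \<open>\<omega> \<ge> 1\<close> above the barrier, the fractional power may be raised to
      \<open>\<omega>\<^sup>2\<close>, a multiple of \<open>y t\<close>. Nothing is lost at \<omega>
      = 1, the only place where the constant is sharp.\<close>
    define \<omega> where "\<omega> = g t * exp (\<sigma>0 * t / 2) / g 0"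
    have \<omega>_sq: "\<omega>\<^sup>2 = y t * exp (\<sigma>0 * t) / y 0"
      by (simp add: \<omega>_def power_mult_distrib power_divide g_sq flip: exp_double)
    also have "\<dots> \<ge> 1"
      using large y0_pos by (simp add: exp_minus field_simps)
    finally have "\<omega>\<^sup>2 \<ge> 1\<^sup>2" by simp
    moreover have "\<omega> \<ge> 0" using g_nonneg by (simp add: \<omega>_def)
    ultimately have \<omega>1: "\<omega> \<ge> 1" by (rule power2_le_imp_le)
    have "\<beta> t \<le> (1/2 * g 0 powr (-1/4) * exp (1/8 * \<sigma>0 * t) * \<sigma>0) * g t powr (1/4)"
      unfolding \<beta>_def by (intro mult_right_mono small t) simp
    also have "\<dots> = \<sigma>0 / 2 * \<omega> powr (1/4)"
      using g_nonneg g0_pos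
      by (simp add: \<omega>_def powr_divide powr_mult powr_minus_divide exp_powr_real mult_ac)
    also have "\<omega> powr (1/4) \<le> \<omega> powr 2" using \<omega>1 by (intro powr_mono) auto
    also have "\<omega> powr 2 = \<omega>\<^sup>2" using \<omega>1 by simp
    finally show ?thesis using sigma0 unfolding \<omega>_sq by simp
  qed

  have decay: "y T \<le> y 0 * exp (- \<sigma>0 * T)" if "T \<ge> 0" for T
  proof (rule nonlinear_decay[where y = y, OF sigma0 y0_pos _ _ that])
    show "continuous_on {0..} y"
      unfolding y_def by (rule continuous_energy[OF op bdd sol])
    fix T :: real assume "T > 0"
    have "compact ((\<lambda>(x, t). u x t) ` (closure \<Omega> \<times> {0..T}))"
      using bdd sol unfolding classical_solution_def
      by (intro compact_continuous_image compact_Times) (auto elim: continuous_on_subset)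
    then obtain M where M: "norm v \<le> M" if "v \<in> (\<lambda>(x, t). u x t) ` (closure \<Omega> \<times> {0..T})" for v
      using compact_imp_bounded bounded_iff by metis
    have uM: "norm (u x t) \<le> M" if "x \<in> \<Omega>" "t \<in> {0..T}" for x t
    proof (rule M)
      have "(x, t) \<in> closure \<Omega> \<times> {0..T}" using closure_subset[of \<Omega>] that by auto
      then show "u x t \<in> (\<lambda>(x, t). u x t) ` (closure \<Omega> \<times> {0..T})" by (rule rev_image_eqI) simp
    qed
    have M_nonneg: "M \<ge> 0"
      using order_trans[OF norm_ge_zero uM[OF x0, of 0]] \<open>T > 0\<close> by simp
    let ?N = "measure lebesgue \<Omega>"
    \<comment> \<open>The constants for closeness of the energies and for the derivative error. They
      depend on \<open>T\<close> only through \<open>M\<close>; in \<open>K2\<close> the cap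
      \<open>\<Delta>\<close> stands in for the time-dependent \<open>\<delta>\<close>.\<close>
    define K1 where "K1 = 4 * real CARD('n) * M * ?N"
    define K2 where "K2 = (8 * (\<Delta> * c\<Omega>) * M + 4 * M1) * CARD('n) * ?N"
    have K1: "K1 \<ge> 0" using M_nonneg by (simp add: K1_def)
    have "\<Delta> \<ge> 0" using \<kappa>_pos sigma0 \<open>cF > 0\<close> by (simp add: \<Delta>_def)
    then have K2: "K2 \<ge> 0" using M_nonneg M1_nonneg \<kappa>_pos by (simp add: K2_def)
    show "\<exists>K\<ge>0. \<forall>\<epsilon>>0. \<exists>E E'. \<forall>t. 0 < t \<and> t \<le> T \<longrightarrow>
           \<bar>E t - y t\<bar> \<le> K * \<epsilon> \<and> (E has_real_derivative E' t) (at t) \<and>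
           (y t \<ge> y 0 * exp (- \<sigma>0 * t) \<longrightarrow>
              E' t \<le> - 2 * \<sigma>0 * y t + \<sigma>0 * (y t * exp (\<sigma>0 * t) / y 0) * y t + K * \<epsilon>)"
    proof (intro exI[of _ "K1 + K2"] conjI allI impI)
      show "K1 + K2 \<ge> 0" using K1 K2 by simp
      fix \<epsilon> :: real assume \<epsilon>: "\<epsilon> > 0"
      then obtain k h G where tr: "truncation \<epsilon> k h G" by (rule truncation_exists)
      define E where "E t = (\<Sum>i\<in>UNIV. 2 * (LINT x|lebesgue_on \<Omega>. G (u x t $ i)))" for t
      have "\<exists>E'. \<bar>E t - y t\<bar> \<le> (K1 + K2) * \<epsilon> \<and> (E has_real_derivative E') (at t) \<and>
           (y t \<ge> y 0 * exp (- \<sigma>0 * t) \<longrightarrow>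
              E' \<le> - 2 * \<sigma>0 * y t + \<sigma>0 * (y t * exp (\<sigma>0 * t) / y 0) * y t + (K1 + K2) * \<epsilon>)"
        if t: "0 < t" "t \<le> T" for t
      proof -
        have uMt: "norm (u x t) \<le> M" if "x \<in> \<Omega>" for x using uM that t by simp
        have "\<bar>E t - y t\<bar> \<le> K1 * \<epsilon>"
          unfolding E_def y_def K1_def by (rule truncated_energy_close[OF op bdd sol tr t(1) uMt])
        also have "\<dots> \<le> (K1 + K2) * \<epsilon>" using K2 \<epsilon> by simp
        finally have close: "\<bar>E t - y t\<bar> \<le> (K1 + K2) * \<epsilon>" .
        obtain \<delta> m where \<delta>: "0 \<le> \<delta>" "\<delta> \<le> \<Delta>" "\<And>i. \<delta> \<le> D t $ i $ i" and m: "m - \<delta> * c\<Omega> \<le> - \<sigma>0 + \<beta> t"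
          and Fu: "AE x in lebesgue_on \<Omega>. F (u x t) x t \<bullet> u x t \<le> m * (norm (u x t))\<^sup>2"
          using balance[of t] t by auto
        obtain E' where E': "(E has_real_derivative E') (at t)"
          and E'_le: "E' \<le> 2 * ((m - \<delta> * c\<Omega>) * y t) + (8 * (\<delta> * c\<Omega>) * M + 4 * M1) * CARD('n) * ?N * \<epsilon>"
          using truncated_energy_derivative[OF op bdd sol tr t(1) uMt poin diag \<delta>(1) \<delta>(3) FM Fu] t
          unfolding E_def y_def by auto
        have "(8 * (\<delta> * c\<Omega>) * M + 4 * M1) * CARD('n) * ?N * \<epsilon> \<le> K2 * \<epsilon>"
          unfolding K2_def using \<delta> \<kappa>_pos M_nonneg \<epsilon>
          by (intro mult_right_mono add_mono mult_left_mono) auto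
        also have "\<dots> \<le> (K1 + K2) * \<epsilon>" using K1 \<epsilon> by simp
        finally have err: "(8 * (\<delta> * c\<Omega>) * M + 4 * M1) * CARD('n) * ?N * \<epsilon> \<le> (K1 + K2) * \<epsilon>" .
        have "E' \<le> - 2 * \<sigma>0 * y t + \<sigma>0 * (y t * exp (\<sigma>0 * t) / y 0) * y t + (K1 + K2) * \<epsilon>"
          if "y t \<ge> y 0 * exp (- \<sigma>0 * t)"
        proof -
          have "m - \<delta> * c\<Omega> \<le> - \<sigma>0 + \<sigma>0 / 2 * (y t * exp (\<sigma>0 * t) / y 0)"
            using m \<beta>_le[OF _ that] t by simp
          then have "(m - \<delta> * c\<Omega>) * y t \<le> (- \<sigma>0 + \<sigma>0 / 2 * (y t * exp (\<sigma>0 * t) / y 0)) * y t"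
            using y_nonneg by (rule mult_right_mono)
          then have "2 * ((m - \<delta> * c\<Omega>) * y t) \<le> 2 * ((- \<sigma>0 + \<sigma>0 / 2 * (y t * exp (\<sigma>0 * t) / y 0)) * y t)"
            by simp
          also have "\<dots> = - 2 * \<sigma>0 * y t + \<sigma>0 * (y t * exp (\<sigma>0 * t) / y 0) * y t"
            by (simp add: algebra_simps)
          finally show ?thesis using E'_le err by linarith
        qed
        then show ?thesis using close E' by blast
      qed
      then show "\<exists>E E'. \<forall>t. 0 < t \<and> t \<le> T \<longrightarrow>
           \<bar>E t - y t\<bar> \<le> (K1 + K2) * \<epsilon> \<and> (E has_real_derivative E' t) (at t) \<and>
           (y t \<ge> y 0 * exp (- \<sigma>0 * t) \<longrightarrow>
              E' t \<le> - 2 * \<sigma>0 * y t + \<sigma>0 * (y t * exp (\<sigma>0 * t) / y 0) * y t + (K1 + K2) * \<epsilon>)"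
        by metis
    qed
  qed
  show ?thesis
  proof (intro allI impI)
    fix t :: real assume t: "t \<ge> 0"
    have "(g t)\<^sup>2 \<le> (g 0 * exp (- (1/2) * \<sigma>0 * t))\<^sup>2"
      using decay[OF t] by (simp add: g_sq power_mult_distrib flip: exp_double)
    then have "g t \<le> g 0 * exp (- (1/2) * \<sigma>0 * t)"
      using g0_pos by (intro power2_le_imp_le[of "g t"]) auto
    then show "L2_norm_on \<Omega> (\<lambda>x. u x t) \<le> g 0 * exp (- (1/2) * \<sigma>0 * t)"
      by (simp only: g_def)
  qed
qed

end
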